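(* Let $T^n=\{[z_0:\cdots:z_n]\in\mathbb{CP}^n : |z_0|=\cdots=|z_n|\}$ be the Clifford torus and let $w:(D^2,\partial D^2)\to(\mathbb{CP}^n,T^n)$ be a holomorphic disc. Then homogeneous coordinate functions of $w$ can be chosen to be finite Blaschke products: $w(z)=[\gamma_0(z):\cdots:\gamma_n(z)]$, where for every $i=0,1,\dots,n$ there are an integer $\mu_i\ge 0$, a real number $\theta_i$ and points $\alpha_{i,j}\in\mathrm{int}(D^2)$ for $j=1,\dots,\mu_i$ such that $$\gamma_i(z)=e^{\sqrt{-1}\,\theta_i}\prod_{j=1}^{\mu_i}\frac{z-\alpha_{i,j}}{1-\overline{\alpha_{i,j}}\,z},$$ and $\bigcap_{i=0}^n\bigcup_{j=1}^{\mu_i}\{\alpha_{i,j}\}=\emptyset$. Moreover, the Maslov index of $w$ is $2\sum_{i=0}^n\mu_i$.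
   Context: $D^2\subset\mathbb{C}$ is the closed unit disc; $\mathbb{CP}^n$ carries its standard complex structure and Fubini-Study symplectic form, for which $T^n$ is Lagrangian. A holomorphic disc is a smooth map $w:D^2\to\mathbb{CP}^n$, holomorphic in the interior, with $w(\partial D^2)\subset T^n$. An empty product equals $1$. Maslov index: trivialize $w^*T\mathbb{CP}^n\cong D^2\times\mathbb{C}^n$ as a symplectic (Hermitian) vector bundle; then $(w|_{\partial D^2})^*T(T^n)$ defines a loop of Lagrangian subspaces $A(\theta)\cdot\mathbb{R}^n\subset\mathbb{C}^n$, $A(\theta)\in U(n)$, and $\mu(w)$ is the degree of the map $S^1\to U(1)$, $\theta\mapsto\det(A(\theta)A(\theta)^t)$. *)

theory Defs
  imports "HOL-Complex_Analysis.Complex_Analysis"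
begin

unbundle no Formal_Power_Series.fps_syntax

section \<open>Complex projective space and its affine charts\<close>

text \<open>The type \<open>'m\<close> indexes the homogeneous coordinates, so \<open>CP^n\<close> is \<open>'n option cproj\<close> with
  \<open>n = CARD('n)\<close>; the coordinate number \<open>0\<close> has index \<^const>\<open>None\<close>.\<close>

definition homog_rel :: "complex^'m \<Rightarrow> complex^'m \<Rightarrow> bool" where
  "homog_rel x y \<longleftrightarrow> x \<noteq> 0 \<and> y \<noteq> 0 \<and> (\<exists>c. y = c *s x)"

quotient_type 'm cproj = "complex^'m::finite" / partial: homog_rel
proof (rule part_equivpI)
  show "\<exists>x::complex^'m. homog_rel x x"
    by (rule exI[of _ "\<chi> i. 1"]) (auto simp: homog_rel_def vec_eq_iff intro!: exI[of _ 1])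
  show "symp (homog_rel :: complex^'m \<Rightarrow> _)"
  proof (rule sympI)
    fix x y :: "complex^'m" assume "homog_rel x y"
    then obtain c where c: "x \<noteq> 0" "y \<noteq> 0" "y = c *s x" by (auto simp: homog_rel_def)
    hence "c \<noteq> 0" by auto
    hence "x = inverse c *s y" using c by (simp add: vec_eq_iff)
    thus "homog_rel y x" using c unfolding homog_rel_def by blast
  qed
  show "transp (homog_rel :: complex^'m \<Rightarrow> _)"
    unfolding homog_rel_def by (rule transpI) (metis vector_smult_assoc)
qed

text \<open>\<open>homog_coords x p\<close>: \<open>p = [x]\<close>, including that \<open>x\<close> is not the zero vector.\<close>

definition homog_coords :: "complex^'m::finite \<Rightarrow> 'm cproj \<Rightarrow> bool" where
  "homog_coords x p \<longleftrightarrow> x \<noteq> 0 \<and> p = abs_cproj x"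

definition chart_domain :: "'m::finite \<Rightarrow> 'm cproj set" where
  "chart_domain i = {p. \<exists>x. homog_coords x p \<and> x $ i \<noteq> 0}"

lift_definition affine_coord :: "'m::finite \<Rightarrow> 'm \<Rightarrow> 'm cproj \<Rightarrow> complex" is
  "\<lambda>i j x. x $ j / x $ i"
  by (auto simp: homog_rel_def)

definition clifford_torus :: "'m::finite cproj set" where
  "clifford_torus = {p. \<exists>x. homog_coords x p \<and> (\<forall>i j. cmod (x $ i) = cmod (x $ j))}"


section \<open>Holomorphic discs\<close>

primrec Ck_on :: "nat \<Rightarrow> 'a::real_normed_vector set \<Rightarrow> ('a \<Rightarrow> 'b::real_normed_vector) \<Rightarrow> bool" where
  "Ck_on 0 U f \<longleftrightarrow> continuous_on U f"
| "Ck_on (Suc k) U f \<longleftrightarrow>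
     (\<forall>x\<in>U. f differentiable (at x)) \<and> (\<forall>v. Ck_on k U (\<lambda>x. frechet_derivative f (at x) v))"

text \<open>Smoothness (over the reals) on a set that need not be open, such as a piece of the closed
  disc: locally, the function extends smoothly to an open set.\<close>

definition smooth_on_set :: "'a::real_normed_vector set \<Rightarrow> ('a \<Rightarrow> 'b::real_normed_vector) \<Rightarrow> bool" where
  "smooth_on_set S f \<longleftrightarrow>
     (\<forall>p\<in>S. \<exists>U g. open U \<and> p \<in> U \<and> (\<forall>k. Ck_on k U g) \<and> (\<forall>x\<in>U \<inter> S. g x = f x))"

text \<open>The \<open>i\<close>-th affine chart is \<open>p \<mapsto> (affine_coord i j p)\<^sub>j\<close> on \<open>chart_domain i\<close>; its
  component \<open>j = i\<close>, usually omitted, is constantly \<open>1\<close>.\<close>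

definition smooth_map_cproj :: "complex set \<Rightarrow> (complex \<Rightarrow> 'm::finite cproj) \<Rightarrow> bool" where
  "smooth_map_cproj D w \<longleftrightarrow>
     (\<forall>i. openin (top_of_set D) {z \<in> D. w z \<in> chart_domain i} \<and>
          (\<forall>j. smooth_on_set {z \<in> D. w z \<in> chart_domain i} (\<lambda>z. affine_coord i j (w z))))"

definition holomorphic_map_cproj :: "complex set \<Rightarrow> (complex \<Rightarrow> 'm::finite cproj) \<Rightarrow> bool" where
  "holomorphic_map_cproj D w \<longleftrightarrow>
     (\<forall>i. openin (top_of_set D) {z \<in> D. w z \<in> chart_domain i} \<and>
          (\<forall>j. (\<lambda>z. affine_coord i j (w z)) holomorphic_on {z \<in> D. w z \<in> chart_domain i}))"

definition holomorphic_disc :: "(complex \<Rightarrow> 'm::finite cproj) \<Rightarrow> bool" where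
  "holomorphic_disc w \<longleftrightarrow>
     smooth_map_cproj (cball 0 1) w \<and> holomorphic_map_cproj (ball 0 1) w \<and>
     w ` sphere 0 1 \<subseteq> clifford_torus"


section \<open>Tangent spaces\<close>

definition cinner :: "complex^'m::finite \<Rightarrow> complex^'m \<Rightarrow> complex" where
  "cinner u v = (\<Sum>i\<in>UNIV. u $ i * cnj (v $ i))"

definition cinner_matrix :: "complex^'m^'m::finite \<Rightarrow> complex^'m^'m \<Rightarrow> complex" where
  "cinner_matrix M N = (\<Sum>i\<in>UNIV. cinner (M $ i) (N $ i))"

text \<open>The tangent space of projective space at a line \<open>L\<close> is \<open>Hom(L, C^m / L) = Hom(L, L\<^sup>\<bottom>)\<close>, and an
  element of the latter is represented by the matrix that extends it by \<open>0\<close> on \<open>L\<^sup>\<bottom>\<close>. In this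
  model the complex structure is multiplication by \<open>\<i>\<close>, and the Fubini-Study Hermitian metric is
  \<^const>\<open>cinner_matrix\<close> (up to a constant factor depending on normalisation).
  \<open>proj_deriv x v\<close> is the derivative at \<open>x \<noteq> 0\<close> in direction \<open>v\<close> of the projection \<open>x \<mapsto> [x]\<close>: the
  homomorphism that maps \<open>x\<close> to the component of \<open>v\<close> orthogonal to \<open>x\<close>.\<close>

definition proj_deriv :: "complex^'m::finite \<Rightarrow> complex^'m \<Rightarrow> complex^'m^'m" where
  "proj_deriv x v =
     (\<chi> i j. (v - (cinner v x / cinner x x) *s x) $ i * cnj (x $ j) / cinner x x)"

text \<open>Velocities at \<open>p\<close> of curves \<open>t \<mapsto> [c t]\<close> in \<open>S\<close>.\<close>

definition tangent_space_cproj :: "'m::finite cproj set \<Rightarrow> 'm cproj \<Rightarrow> (complex^'m^'m) set" where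
  "tangent_space_cproj S p =
     {proj_deriv (c 0) v | (c :: real \<Rightarrow> complex^'m) v.
        homog_coords (c 0) p \<and> (\<forall>t. \<exists>q\<in>S. homog_coords (c t) q) \<and>
        (c has_vector_derivative v) (at 0)}"


section \<open>The Maslov index\<close>

text \<open>Unitary trivializations \<open>D\<^sup>2 \<times> C^n \<rightarrow> w\<^sup>*T(CP^n)\<close>.\<close>

definition unitary_trivialization ::
  "(complex \<Rightarrow> ('n::finite) option cproj) \<Rightarrow>
   (complex \<Rightarrow> complex^'n \<Rightarrow> complex^'n option^'n option) \<Rightarrow> bool" where
  "unitary_trivialization w \<Phi> \<longleftrightarrow>
     continuous_on (cball 0 1 \<times> UNIV) (\<lambda>(z, u). \<Phi> z u) \<and>
     (\<forall>z\<in>cball 0 1.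
        (\<forall>u v. \<Phi> z (u + v) = \<Phi> z u + \<Phi> z v) \<and>
        (\<forall>c u. \<Phi> z (c *s u) = mat c ** \<Phi> z u) \<and>
        (\<forall>u v. cinner_matrix (\<Phi> z u) (\<Phi> z v) = cinner u v) \<and>
        range (\<Phi> z) = tangent_space_cproj UNIV (w z))"

definition unitary_matrix :: "complex^'n^'n::finite \<Rightarrow> bool" where
  "unitary_matrix A \<longleftrightarrow>
     A ** map_matrix cnj (transpose A) = mat 1 \<and> map_matrix cnj (transpose A) ** A = mat 1"

text \<open>\<open>A \<zeta> \<cdot> R^n\<close> is the tangent space of the Clifford torus at \<open>w \<zeta>\<close>, seen in the trivialization
  \<open>\<Phi>\<close>. No continuity of \<open>A\<close> is asked for: \<open>A \<zeta>\<close> is determined up to right multiplication by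
  elements of \<open>O(n)\<close>, so \<open>A \<zeta> ** transpose (A \<zeta>)\<close> depends only on the subspace.\<close>

definition lagrangian_frame ::
  "(complex \<Rightarrow> ('n::finite) option cproj) \<Rightarrow>
   (complex \<Rightarrow> complex^'n \<Rightarrow> complex^'n option^'n option) \<Rightarrow>
   (complex \<Rightarrow> complex^'n^'n) \<Rightarrow> bool" where
  "lagrangian_frame w \<Phi> A \<longleftrightarrow>
     (\<forall>\<zeta>\<in>sphere 0 1. unitary_matrix (A \<zeta>) \<and>
        {A \<zeta> *v u | u. \<forall>k. u $ k \<in> \<real>} =
        {u. \<Phi> \<zeta> u \<in> tangent_space_cproj clifford_torus (w \<zeta>)})"

text \<open>The degree of a map from the unit circle to the unit circle.\<close>

definition circle_degree :: "(complex \<Rightarrow> complex) \<Rightarrow> complex" where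
  "circle_degree f = winding_number (f \<circ> circlepath 0 1) 0"

definition maslov_index :: "(complex \<Rightarrow> ('n::finite) option cproj) \<Rightarrow> int" where
  "maslov_index w =
     (THE m. \<exists>\<Phi> A. unitary_trivialization w \<Phi> \<and> lagrangian_frame w \<Phi> A \<and>
        circle_degree (\<lambda>\<zeta>. det (A \<zeta> ** transpose (A \<zeta>))) = of_int m)"


section \<open>Finite Blaschke products\<close>

definition blaschke_product :: "real \<Rightarrow> nat \<Rightarrow> (nat \<Rightarrow> complex) \<Rightarrow> complex \<Rightarrow> complex" where
  "blaschke_product \<theta> m a z =
     exp (\<i> * complex_of_real \<theta>) * (\<Prod>j=1..m. (z - a j) / (1 - cnj (a j) * z))"

end

theory Submission
  imports Defs
begin

text \<open>Near a point where the coordinate \<open>z\<^sub>0\<close> of \<open>w\<close> vanishes, the affine coordinates in the chart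
  \<open>z\<^sub>0 \<noteq> 0\<close> have poles, and there are finitely many such points because \<open>w\<close> maps the circle to the torus.
  Multiplying by a Blaschke product clears these poles and gives a lift \<open>g\<close> of \<open>w\<close> without common zeros whose
  coordinates have modulus 1 on the circle; by the maximum principle each of them is a Blaschke product.

  A unitary trivialization of \<open>w\<^sup>*T(CP^n)\<close> amounts to a continuous unitary matrix \<open>U\<close> of size \<open>n + 1\<close>
  on the disc whose first column is \<open>x = g / |g|\<close>: the other columns are a frame of the orthogonal complement of
  \<open>x\<close>. Such a \<open>U\<close> exists by transporting along radii. On the circle, with \<open>G\<close> the diagonal matrix of the
  \<open>\<i> * g\<^sub>i\<close>, the torus has the tangent space \<open>G t\<close>, \<open>t\<close> real with sum 0, and \<open>G (1, \<dots>, 1)\<close> is proportional to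
  \<open>\<i> x\<close>. Hence \<open>U\<close> times the block matrix of \<open>\<i>\<close> and \<open>A\<close> is \<open>G\<close> times a real orthogonal matrix, so that
  \<open>det (A A\<^sup>t) = - det G\<^sup>2 / det U\<^sup>2\<close>. Since \<open>det U\<close> extends to the disc without zeros, the degree is that of
  the square of the product of the \<open>g\<^sub>i\<close>.\<close>

section \<open>Homogeneous coordinates\<close>

lemma homog_rel_refl: "x \<noteq> 0 \<Longrightarrow> homog_rel x x"
  unfolding homog_rel_def by (auto intro!: exI[of _ 1])

lemma homog_coords_exists: "\<exists>x. homog_coords x p"
proof -
  obtain x where "homog_rel x x" "abs_cproj x = p"
    using Quotient_cproj by (metis Quotient_abs_rep Quotient_rep_reflp)
  thus ?thesis unfolding homog_coords_def homog_rel_def by metis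
qed

lemma homog_coords_cmult:
  assumes "homog_coords x p" "c \<noteq> 0"
  shows "homog_coords (c *s x) p"
proof -
  have "c *s x \<noteq> 0" "x \<noteq> 0" using assms by (auto simp: homog_coords_def vec_eq_iff)
  hence "homog_rel x (c *s x)" by (auto simp: homog_rel_def)
  thus ?thesis using assms \<open>c *s x \<noteq> 0\<close>
    using Quotient_rel_abs[OF Quotient_cproj] by (force simp: homog_coords_def)
qed

lemma homog_coords_unique:
  assumes "homog_coords x p" "homog_coords y p"
  obtains c where "c \<noteq> 0" "y = c *s x"
proof -
  have "homog_rel x y" using assms Quotient_rel[OF Quotient_cproj, of x y] homog_rel_refl
    unfolding homog_coords_def by metis
  thus ?thesis using that by (auto simp: homog_rel_def)
qed

lemma chart_domain_iff:
  assumes "homog_coords x p"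
  shows "p \<in> chart_domain i \<longleftrightarrow> x $ i \<noteq> 0"
proof
  assume "p \<in> chart_domain i"
  then obtain y where y: "homog_coords y p" "y $ i \<noteq> 0" by (auto simp: chart_domain_def)
  then obtain c where "y = c *s x" using homog_coords_unique assms by blast
  thus "x $ i \<noteq> 0" using y by auto
qed (use assms in \<open>auto simp: chart_domain_def\<close>)

lemma affine_coord_eq:
  assumes "homog_coords x p"
  shows "affine_coord i j p = x $ j / x $ i"
  using assms unfolding homog_coords_def by (simp add: affine_coord.abs_eq homog_rel_refl)

lemma clifford_torus_iff:
  assumes "homog_coords x p"
  shows "p \<in> clifford_torus \<longleftrightarrow> (\<forall>i j. cmod (x $ i) = cmod (x $ j))"
proof
  assume "p \<in> clifford_torus"
  then obtain y where y: "homog_coords y p" "\<And>i j. cmod (y $ i) = cmod (y $ j)"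
    unfolding clifford_torus_def by blast
  then obtain c where c: "c \<noteq> 0" "y = c *s x" using homog_coords_unique assms by blast
  show "\<forall>i j. cmod (x $ i) = cmod (x $ j)"
    using y(2) c by (simp add: norm_mult)
qed (use assms in \<open>auto simp: clifford_torus_def\<close>)

lemma clifford_torus_nonzero:
  assumes "homog_coords x p" "p \<in> clifford_torus"
  shows "x $ i \<noteq> 0"
proof
  assume "x $ i = 0"
  hence "x $ j = 0" for j using assms clifford_torus_iff[OF assms(1)] by (metis norm_eq_zero)
  thus False using assms by (auto simp: homog_coords_def vec_eq_iff)
qed

lemma chart_domain_cover: "\<exists>i. p \<in> chart_domain i"
  using homog_coords_exists[of p] chart_domain_iff
  by (metis homog_coords_def vec_eq_iff zero_index)

lemma affine_coord_change:
  assumes "p \<in> chart_domain k"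
  shows "affine_coord i j p = affine_coord k j p / affine_coord k i p"
  using homog_coords_exists[of p] assms by (auto simp: affine_coord_eq chart_domain_iff)

lemma chart_domain_iff_affine:
  assumes "p \<in> chart_domain k"
  shows "p \<in> chart_domain i \<longleftrightarrow> affine_coord k i p \<noteq> 0"
  using homog_coords_exists[of p] assms by (auto simp: affine_coord_eq chart_domain_iff)

lemma homog_coords_affine:
  assumes "p \<in> chart_domain i"
  shows "homog_coords (\<chi> j. affine_coord i j p) p"
proof -
  obtain x where x: "homog_coords x p" using homog_coords_exists by blast
  hence "x $ i \<noteq> 0" using assms chart_domain_iff by blast
  moreover have "(\<chi> j. affine_coord i j p) = inverse (x $ i) *s x"
    using x by (simp add: affine_coord_eq vec_eq_iff divide_inverse mult.commute)
  ultimately show ?thesis using homog_coords_cmult[OF x, of "inverse (x $ i)"] by simp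
qed

lemma clifford_torus_chart: "p \<in> clifford_torus \<Longrightarrow> p \<in> chart_domain i"
  using homog_coords_exists chart_domain_iff clifford_torus_nonzero by blast

lemma clifford_torus_affine:
  assumes "p \<in> clifford_torus"
  shows "cmod (affine_coord i j p) = 1"
proof -
  obtain x where x: "homog_coords x p" using homog_coords_exists by blast
  thus ?thesis using clifford_torus_iff[OF x] clifford_torus_nonzero[OF x assms] assms
    by (auto simp: affine_coord_eq norm_divide)
qed

section \<open>Blaschke products\<close>

definition blaschke_factor :: "complex \<Rightarrow> complex \<Rightarrow> complex" where
  "blaschke_factor a z = (z - a) / (1 - cnj a * z)"

lemma blaschke_denom:
  assumes "a \<in> ball 0 1" "z \<in> cball 0 1"
  shows "1 - cnj a * z \<noteq> 0"
proof
  assume "1 - cnj a * z = 0"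
  hence "cmod a * cmod z = 1" by (metis complex_mod_cnj eq_iff_diff_eq_0 norm_mult norm_one)
  moreover have "cmod a * cmod z \<le> cmod a * 1" using assms by (intro mult_left_mono) auto
  ultimately show False using assms by simp
qed

lemma blaschke_factor_holomorphic:
  "a \<in> ball 0 1 \<Longrightarrow> S \<subseteq> cball 0 1 \<Longrightarrow> blaschke_factor a holomorphic_on S"
  unfolding blaschke_factor_def by (intro holomorphic_intros) (use blaschke_denom in auto)

lemma blaschke_factor_continuous:
  "a \<in> ball 0 1 \<Longrightarrow> continuous_on (cball 0 1) (blaschke_factor a)"
  using blaschke_factor_holomorphic holomorphic_on_imp_continuous_on by blast

lemma blaschke_factor_eq_0_iff:
  assumes "a \<in> ball 0 1" "z \<in> cball 0 1"
  shows "blaschke_factor a z = 0 \<longleftrightarrow> z = a"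
  using blaschke_denom[OF assms] by (simp add: blaschke_factor_def)

text \<open>On the unit circle the denominator is \<open>z\<close> times the conjugate of the numerator.\<close>

lemma norm_blaschke_factor:
  assumes "a \<in> ball 0 1" "z \<in> sphere 0 1"
  shows "cmod (blaschke_factor a z) = 1"
proof -
  have "z * cnj z = 1" using assms by (simp add: complex_norm_square[symmetric])
  hence "1 - cnj a * z = z * cnj (z - a)" by (simp add: algebra_simps)
  hence "cmod (1 - cnj a * z) = cmod (z - a)" using assms
    by (metis complex_mod_cnj mult_1 norm_mult mem_sphere_0)
  moreover have "1 - cnj a * z \<noteq> 0" using assms by (intro blaschke_denom) auto
  ultimately show ?thesis unfolding blaschke_factor_def norm_divide
    by (metis divide_self norm_eq_zero)
qed

text \<open>Agreement is asked for only on the closed disc, because functions derived from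
  \<open>w\<close> are arbitrary outside it.\<close>

definition finite_blaschke :: "(complex \<Rightarrow> complex) \<Rightarrow> bool" where
  "finite_blaschke g \<longleftrightarrow> (\<exists>\<theta> m a. (\<forall>j\<in>{1..m}. a j \<in> ball 0 1) \<and>
     (\<forall>z\<in>cball 0 1. g z = blaschke_product \<theta> m a z))"

lemma finite_blaschke_mult_factor:
  assumes "finite_blaschke g" "p \<in> ball 0 1"
  shows "finite_blaschke (\<lambda>z. blaschke_factor p z ^ n * g z)"
proof (induction n)
  case (Suc n)
  then obtain \<theta> m a where a: "\<forall>j\<in>{1..m}. a j \<in> ball 0 1"
    "\<forall>z\<in>cball 0 1. blaschke_factor p z ^ n * g z = blaschke_product \<theta> m a z"
    unfolding finite_blaschke_def by blast
  \<comment> \<open>The new zero takes the index \<open>Suc m\<close>, which leaves the factors with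
    indices \<open>1..m\<close> alone.\<close>
  let ?a = "a(Suc m := p)"
  have "(\<Prod>j=1..m. (z - ?a j) / (1 - cnj (?a j) * z)) = (\<Prod>j=1..m. (z - a j) / (1 - cnj (a j) * z))"
    for z by (rule prod.cong) auto
  hence "\<forall>z\<in>cball 0 1. blaschke_factor p z ^ Suc n * g z = blaschke_product \<theta> (Suc m) ?a z"
    using a(2) by (simp add: blaschke_product_def blaschke_factor_def mult_ac)
  moreover have "\<forall>j\<in>{1..Suc m}. ?a j \<in> ball 0 1" using a assms(2) by (auto simp: le_Suc_eq)
  ultimately show ?case unfolding finite_blaschke_def by blast
qed (use assms in simp)

section \<open>Functions of modulus 1 on the circle and the maximum principle\<close>

definition unimodular_disc :: "(complex \<Rightarrow> complex) \<Rightarrow> bool" where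
  "unimodular_disc g \<longleftrightarrow> g holomorphic_on ball 0 1 \<and> continuous_on (cball 0 1) g \<and>
     (\<forall>z\<in>sphere 0 1. cmod (g z) = 1)"

lemma unimodular_disc_le_1:
  assumes "unimodular_disc g" "z \<in> cball 0 1"
  shows "cmod (g z) \<le> 1"
  by (rule maximum_modulus_frontier[of g "cball 0 1"])
    (use assms in \<open>auto simp: unimodular_disc_def interior_cball frontier_cball\<close>)

text \<open>A constant value would be \<open>0\<close> because of \<open>p\<close>, and by
  continuity it would persist at the boundary point \<open>1\<close>, where the modulus is
  1.\<close>

lemma unimodular_disc_not_constant:
  assumes g: "unimodular_disc g" and p: "p \<in> ball 0 1" "g p = 0"
  shows "\<not> g constant_on ball 0 1"
proof
  assume "g constant_on ball 0 1"
  hence "\<And>z. z \<in> ball 0 1 \<Longrightarrow> g z = 0" using p unfolding constant_on_def by metis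
  hence "g 1 = 0" using g continuous_constant_on_closure[of "ball 0 1" g 0 1]
    by (simp add: unimodular_disc_def)
  thus False using g by (auto simp: unimodular_disc_def dest: bspec[of _ _ 1])
qed

text \<open>Dividing by the full multiplicity removes \<open>p\<close> from the zero set, so that
  the number of distinct zeros can serve as an induction measure. Blaschke factors have modulus 1 on
  the circle, so the quotient stays in the class.\<close>

lemma unimodular_disc_divide_zero:
  assumes g: "unimodular_disc g" and p: "p \<in> ball 0 1" "g p = 0"
  obtains n h where "unimodular_disc h" "h p \<noteq> 0"
    "\<And>z. z \<in> cball 0 1 \<Longrightarrow> g z = blaschke_factor p z ^ n * h z"
proof -
  have holg: "g holomorphic_on ball 0 1" and contg: "continuous_on (cball 0 1) g"
    using g by (auto simp: unimodular_disc_def)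
  obtain n r q where q: "0 < n" "0 < r" "ball p r \<subseteq> ball 0 1" "q holomorphic_on ball p r"
      "\<And>z. z \<in> ball p r \<Longrightarrow> g z = (z - p) ^ n * q z" "\<And>z. z \<in> ball p r \<Longrightarrow> q z \<noteq> 0"
    using holomorphic_factor_zero_nonconstant[OF holg open_ball connected_ball p
          unimodular_disc_not_constant[OF assms]] by metis
  \<comment> \<open>The value at \<open>p\<close> is the limit of the quotient: the powers of
    \<open>z - p\<close> cancel and leave \<open>q\<close> times a power of the denominator of the
    Blaschke factor.\<close>
  define h where "h = (\<lambda>z. if z = p then q p * (1 - cnj p * p) ^ n else g z / blaschke_factor p z ^ n)"
  have h1: "h z = q z * (1 - cnj p * z) ^ n" if z: "z \<in> ball p r" for z
  proof -
    have "z \<in> cball 0 1" using z q(3) by (meson ball_subset_cball subsetD)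
    thus ?thesis using q(5)[OF z] blaschke_denom[OF p(1), of z]
      by (simp add: h_def blaschke_factor_def power_divide field_simps)
  qed
  have nz: "blaschke_factor p z \<noteq> 0" if "z \<in> cball 0 1 - {p}" for z
    using that blaschke_factor_eq_0_iff[OF p(1)] by auto
  have loc: "h holomorphic_on ball p r"
    by (rule holomorphic_transform[of "\<lambda>z. q z * (1 - cnj p * z) ^ n"])
      (use h1 q(4) in \<open>auto intro!: holomorphic_intros\<close>)
  have "(\<lambda>z. g z / blaschke_factor p z ^ n) holomorphic_on (ball 0 1 - {p})"
    using nz holg blaschke_factor_holomorphic[OF p(1) ball_subset_cball]
    by (intro holomorphic_intros) (auto intro: holomorphic_on_subset)
  hence "h holomorphic_on (ball 0 1 - {p})"
    by (rule holomorphic_transform) (auto simp: h_def)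
  hence "h holomorphic_on (ball 0 1 - {p}) \<union> ball p r"
    using loc by (intro holomorphic_on_Un) auto
  moreover have "(ball 0 1 - {p}) \<union> ball p r = ball 0 1" using p q by auto
  ultimately have holh: "h holomorphic_on ball 0 1" by simp
  have "continuous_on (cball 0 1 - {p}) (\<lambda>z. g z / blaschke_factor p z ^ n)"
    using nz contg p blaschke_factor_continuous
    by (intro continuous_intros) (auto intro: continuous_on_subset)
  hence c1: "continuous_on (cball 0 1 - {p}) h"
    by (rule continuous_on_eq) (auto simp: h_def)
  \<comment> \<open>The quotient is continuous up to the circle away from \<open>p\<close>, and
    holomorphy gives continuity near \<open>p\<close>; both pieces are relatively open.\<close>
  have un: "(cball 0 1 - {p}) \<union> ball p r = cball 0 1"
    using p q(2,3) ball_subset_cball[of "0::complex" 1] by auto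
  have "openin (top_of_set (cball 0 1)) (cball 0 1 - {p})"
    by (auto simp: openin_open intro: exI[of _ "- {p}"])
  moreover have "openin (top_of_set (cball 0 1)) (ball p r)"
    using q(3) ball_subset_cball[of "0::complex" 1] by (intro open_subset) auto
  ultimately have "continuous_on (cball 0 1) h"
    using c1 continuous_on_Un_local_open[of "cball 0 1 - {p}" "ball p r" h] loc
    by (simp add: un holomorphic_on_imp_continuous_on)
  hence "unimodular_disc h"
    using holh g p norm_blaschke_factor[OF p(1)]
    by (auto simp: unimodular_disc_def h_def norm_divide norm_power)
  moreover have "h p \<noteq> 0" using h1[of p] q blaschke_denom[OF p(1), of p] p by auto
  moreover have "g z = blaschke_factor p z ^ n * h z" if "z \<in> cball 0 1" for z
    using that nz[of z] p q(1) by (auto simp: h_def blaschke_factor_def)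
  ultimately show ?thesis using that by blast
qed

text \<open>The zeros in the closed disc form a compact set that misses the circle, and infinitely
  many of them would force \<open>g\<close> to vanish identically.\<close>

lemma unimodular_disc_finite_zeros:
  assumes g: "unimodular_disc g"
  shows "finite {z \<in> ball 0 1. g z = 0}"
proof (cases "\<exists>p\<in>ball 0 1. g p = 0")
  case True
  let ?Z = "{z \<in> cball 0 1. g z = 0}"
  have "compact ?Z"
    using g continuous_closed_preimage_constant[of "cball 0 1" g 0] compact_Int_closed[of "cball 0 1" ?Z]
    by (simp add: unimodular_disc_def Int_def conj_ac)
  moreover have "?Z \<subseteq> ball 0 1" using g by (fastforce simp: unimodular_disc_def dest: bspec)
  ultimately have "finite {z \<in> ?Z. g z = 0}"
    using g True unimodular_disc_not_constant[OF g]
    by (intro holomorphic_compact_finite_zeros[of g "ball 0 1"]) (auto simp: unimodular_disc_def)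
  thus ?thesis by (rule rev_finite_subset) auto
next
  case False
  hence "{z \<in> ball 0 1. g z = 0} = {}" by auto
  thus ?thesis by (metis finite.emptyI)
qed

text \<open>The maximum principle for \<open>g\<close> and for its inverse shows that the modulus is
  1 throughout; since it attains its maximum inside, \<open>g\<close> is constant.\<close>

lemma unimodular_disc_constant:
  assumes g: "unimodular_disc g" and nz: "\<And>z. z \<in> ball 0 1 \<Longrightarrow> g z \<noteq> 0"
  obtains c where "cmod c = 1" "\<And>z. z \<in> cball 0 1 \<Longrightarrow> g z = c"
proof -
  have nz': "g z \<noteq> 0" if "z \<in> cball 0 1" for z
    using nz[of z] g that by (fastforce simp: unimodular_disc_def dest: bspec[of _ _ z])
  have "unimodular_disc (\<lambda>z. inverse (g z))"
    using g nz' by (auto simp: unimodular_disc_def norm_inverse intro!: holomorphic_intros continuous_intros)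
  hence one: "cmod (g z) = 1" if "z \<in> cball 0 1" for z
    using unimodular_disc_le_1[OF g that] unimodular_disc_le_1[OF _ that] nz'[OF that]
    by (fastforce simp: norm_inverse inverse_le_1_iff)
  have "g constant_on ball 0 1"
    by (rule maximum_modulus_principle[of _ _ "ball 0 1" 0])
      (use g one in \<open>auto simp: unimodular_disc_def\<close>)
  then obtain c where c: "\<And>z. z \<in> ball 0 1 \<Longrightarrow> g z = c" by (auto simp: constant_on_def)
  have "g z = c" if "z \<in> cball 0 1" for z
    by (rule continuous_constant_on_closure[of "ball 0 1" g]) (use g c that in \<open>auto simp: unimodular_disc_def\<close>)
  moreover from this have "cmod c = 1" using one[of 0] by simp
  ultimately show ?thesis using that by blast
qed

text \<open>Strong induction on the number of distinct zeros in the open disc; a function without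
  zeros contributes only the phase of the product.\<close>

lemma unimodular_disc_imp_blaschke:
  "unimodular_disc g \<Longrightarrow> finite_blaschke g"
proof (induction "card {z \<in> ball 0 1. g z = 0}" arbitrary: g rule: less_induct)
  case less
  show ?case
  proof (cases "\<exists>p\<in>ball 0 1. g p = 0")
    case True
    then obtain p where p: "p \<in> ball 0 1" "g p = 0" by blast
    obtain n h where h: "unimodular_disc h" "h p \<noteq> 0"
      and eq: "\<And>z. z \<in> cball 0 1 \<Longrightarrow> g z = blaschke_factor p z ^ n * h z"
      using unimodular_disc_divide_zero[OF less.prems p] by blast
    have "{z \<in> ball 0 1. h z = 0} \<subseteq> {z \<in> ball 0 1. g z = 0} - {p}" using eq h(2) by auto
    hence "{z \<in> ball 0 1. h z = 0} \<subset> {z \<in> ball 0 1. g z = 0}" using p by blast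
    hence "card {z \<in> ball 0 1. h z = 0} < card {z \<in> ball 0 1. g z = 0}"
      by (intro psubset_card_mono unimodular_disc_finite_zeros less.prems)
    hence "finite_blaschke h" using less.hyps h(1) by blast
    hence "finite_blaschke (\<lambda>z. blaschke_factor p z ^ n * h z)"
      using finite_blaschke_mult_factor p by blast
    thus ?thesis using eq unfolding finite_blaschke_def by simp
  next
    case False
    then obtain c where c: "cmod c = 1" "\<And>z. z \<in> cball 0 1 \<Longrightarrow> g z = c"
      using unimodular_disc_constant[OF less.prems] by blast
    have "c = exp (\<i> * of_real (Arg c))" using c by (metis Arg_eq mult_1 norm_zero of_real_1 zero_neq_one)
    hence "\<forall>z\<in>cball 0 1. g z = blaschke_product (Arg c) 0 (\<lambda>_. 0) z"
      using c by (simp add: blaschke_product_def)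
    thus ?thesis unfolding finite_blaschke_def by (intro exI[of _ "Arg c"] exI[of _ 0]) auto
  qed
qed

section \<open>Lifting a holomorphic disc to homogeneous coordinates\<close>

lemma smooth_on_set_imp_continuous_on:
  assumes "smooth_on_set S f"
  shows "continuous_on S f"
  unfolding continuous_on_eq_continuous_within
proof
  fix p assume p: "p \<in> S"
  then obtain U g where U: "open U" "p \<in> U" "\<forall>k. Ck_on k U g" "\<forall>x\<in>U \<inter> S. g x = f x"
    using assms unfolding smooth_on_set_def by blast
  have "continuous_on U g" using U(3) Ck_on.simps(1) by blast
  hence "continuous (at p within S) g"
    using U(1,2) continuous_on_eq_continuous_at continuous_at_imp_continuous_at_within by blast
  moreover have "\<forall>\<^sub>F x in at p within S. g x = f x"
    unfolding eventually_at_topological using U by blast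
  ultimately show "continuous (at p within S) f"
    using U p by (simp add: continuous_within tendsto_cong)
qed

text \<open>\<open>i0\<close> is a fixed reference coordinate: the lift starts from the affine chart
  in which this coordinate is normalized to 1.\<close>

locale holo_disc =
  fixes w :: "complex \<Rightarrow> 'm::finite cproj" and i0 :: 'm
  assumes disc: "holomorphic_disc w"
begin

definition V :: "'m \<Rightarrow> complex set" where
  "V i = {z \<in> cball 0 1. w z \<in> chart_domain i}"

definition f :: "'m \<Rightarrow> 'm \<Rightarrow> complex \<Rightarrow> complex" where
  "f i j z = affine_coord i j (w z)"

definition S :: "complex set" where
  "S = cball 0 1 - V i0"

lemma openin_V: "openin (top_of_set (cball 0 1)) (V i)"
  using disc unfolding holomorphic_disc_def smooth_map_cproj_def V_def by blast

lemma continuous_f: "continuous_on (V i) (f i j)"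
  unfolding V_def f_def
  using disc smooth_on_set_imp_continuous_on unfolding holomorphic_disc_def smooth_map_cproj_def by blast

lemma open_V: "open (V i \<inter> ball 0 1)"
proof -
  obtain T where "open T" "V i = cball 0 1 \<inter> T" using openin_V openin_open by metis
  moreover from this have "V i \<inter> ball 0 1 = T \<inter> ball 0 1" by auto
  ultimately show ?thesis by auto
qed

lemma holomorphic_f: "f i j holomorphic_on V i \<inter> ball 0 1"
proof -
  have "V i \<inter> ball 0 1 = {z \<in> ball 0 1. w z \<in> chart_domain i}" by (auto simp: V_def)
  thus ?thesis
    using disc unfolding holomorphic_disc_def holomorphic_map_cproj_def f_def by simp
qed

lemma sphere_torus: "z \<in> sphere 0 1 \<Longrightarrow> w z \<in> clifford_torus"
  using disc unfolding holomorphic_disc_def by blast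

lemma sphere_V: "z \<in> sphere 0 1 \<Longrightarrow> z \<in> V i"
  using sphere_torus[of z] clifford_torus_chart[of "w z" i] by (simp add: V_def)

lemma V_cover: "z \<in> cball 0 1 \<Longrightarrow> \<exists>k. z \<in> V k"
  using chart_domain_cover by (auto simp: V_def)

text \<open>In the interior this describes \<open>S\<close> within each chart as the zeros of a
  holomorphic function, which makes the identity theorem and factorization at a zero
  available.\<close>

lemma S_iff: "z \<in> V k \<Longrightarrow> z \<in> S \<longleftrightarrow> f k i0 z = 0"
  using chart_domain_iff_affine[of "w z" k i0] by (auto simp: V_def S_def f_def)

lemma S_subset: "S \<subseteq> ball 0 1"
proof
  fix z assume "z \<in> S"
  hence "z \<notin> V i0" "z \<in> cball 0 1" by (auto simp: S_def)
  thus "z \<in> ball 0 1" using sphere_V[of z i0] by (cases "cmod z = 1") auto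
qed

lemma compact_S: "compact S"
proof -
  have "closedin (top_of_set (cball 0 1)) S"
    unfolding S_def by (intro closedin_diff openin_V closedin_subtopology_refl[THEN iffD2]) auto
  thus ?thesis by (rule closedin_compact[OF compact_cball])
qed

lemma local_ball:
  assumes "z \<in> ball 0 1"
  obtains k e where "e > 0" "ball z e \<subseteq> V k \<inter> ball 0 1"
proof -
  obtain k where "z \<in> V k" using V_cover assms by fastforce
  thus ?thesis using that open_V[of k] assms by (meson IntI open_contains_ball)
qed

text \<open>The function with zero set \<open>S\<close> depends on the chart, so the identity
  theorem is used on small balls. It makes the interior of \<open>S\<close> relatively closed in the
  open disc; if nonempty, it would be the whole disc by connectedness, and the closed set
  \<open>S\<close> would contain the circle.\<close>

lemma interior_S: "interior S = {}"
proof (rule ccontr)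
  assume ne: "interior S \<noteq> {}"
  have "x \<in> interior S" if x: "x \<in> ball 0 1" "x \<in> closure (interior S)" for x
  proof -
    obtain k e where e: "e > 0" "ball x e \<subseteq> V k \<inter> ball 0 1" using local_ball x by blast
    have "ball x e \<inter> interior S \<noteq> {}" 
      using x(2) e(1) open_Int_closure_eq_empty[of "ball x e" "interior S"] centre_in_ball[of x e]
      by blast
    moreover have "f k i0 z = 0" if "z \<in> ball x e \<inter> interior S" for z
      using that e(2) S_iff[of z k] interior_subset[of S] by blast
    ultimately have "f k i0 z = 0" if "z \<in> ball x e" for z
      using that holomorphic_on_subset[OF holomorphic_f e(2)]
      by - (rule analytic_continuation_open[of "ball x e \<inter> interior S" "ball x e" "f k i0" "\<lambda>_. 0"], auto)
    hence "ball x e \<subseteq> S" using S_iff e(2) by blast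
    thus ?thesis using e(1) mem_interior by blast
  qed
  hence "closedin (top_of_set (ball 0 1)) (interior S)"
    using S_subset interior_subset[of S] closure_subset[of "interior S"]
    unfolding closedin_closed by (intro exI[of _ "closure (interior S)"]) auto
  moreover have "openin (top_of_set (ball 0 1)) (interior S)"
    using S_subset interior_subset[of S] by (intro open_subset) auto
  ultimately have "interior S = ball 0 1"
    using ne connected_clopen[of "ball (0::complex) 1"] by auto
  hence "cball 0 1 \<subseteq> S"
    using interior_subset[of S] compact_imp_closed[OF compact_S] closure_minimal[of "ball 0 1" S]
    by simp
  thus False using subset_trans[OF _ S_subset, THEN subsetD, of "cball 0 1" 1] by simp
qed

text \<open>Since \<open>S\<close> has no interior, \<open>f k i0\<close> is not constant near
  \<open>p\<close>. The order \<open>n\<close> of its zero is the largest pole order to be cleared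
  at \<open>p\<close>.\<close>

lemma local_factor:
  assumes p: "p \<in> S"
  obtains k n r q where "0 < r" "ball p r \<subseteq> V k \<inter> ball 0 1" "q holomorphic_on ball p r"
    "0 < n" "\<And>z. z \<in> ball p r \<Longrightarrow> f k i0 z = (z - p) ^ n * q z"
    "\<And>z. z \<in> ball p r \<Longrightarrow> q z \<noteq> 0"
proof -
  obtain k e where e: "e > 0" "ball p e \<subseteq> V k \<inter> ball 0 1"
    by (rule local_ball[OF subsetD[OF S_subset p]])
  have 0: "f k i0 p = 0" using S_iff p e by (meson IntE centre_in_ball subsetD)
  have nc: "\<not> f k i0 constant_on ball p e"
  proof
    assume "f k i0 constant_on ball p e"
    hence "f k i0 z = 0" if "z \<in> ball p e" for z using that 0 e(1) unfolding constant_on_def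
      by (metis centre_in_ball)
    hence "ball p e \<subseteq> S" using S_iff e(2) by blast
    thus False using e(1) interior_S mem_interior by blast
  qed
  obtain q r n where "0 < n" "0 < r" "ball p r \<subseteq> ball p e" "q holomorphic_on ball p r"
      "\<And>z. z \<in> ball p r \<Longrightarrow> f k i0 z = (z - p) ^ n * q z" "\<And>z. z \<in> ball p r \<Longrightarrow> q z \<noteq> 0"
    by (rule holomorphic_factor_zero_nonconstant[OF holomorphic_on_subset[OF holomorphic_f e(2)]
          open_ball connected_ball _ 0 nc]) (use e(1) in auto)
  thus ?thesis using that[of r k q n] e(2) by blast
qed

lemma isolated_S:
  assumes "ball p r \<subseteq> V k" "\<And>z. z \<in> ball p r \<Longrightarrow> f k i0 z = (z - p) ^ n * q z"
    "\<And>z. z \<in> ball p r \<Longrightarrow> q z \<noteq> 0" "z \<in> ball p r" "z \<in> S"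
  shows "z = p"
  using assms S_iff[of z k] by auto

text \<open>The local factorization isolates the points of the compact set \<open>S\<close>.\<close>

lemma finite_S: "finite S"
proof -
  have "\<not> p islimpt S" if p: "p \<in> S" for p
  proof -
    obtain k n r q where "0 < r" "ball p r \<subseteq> V k \<inter> ball 0 1" "q holomorphic_on ball p r"
      "0 < n" "\<And>z. z \<in> ball p r \<Longrightarrow> f k i0 z = (z - p) ^ n * q z" "\<And>z. z \<in> ball p r \<Longrightarrow> q z \<noteq> 0"
      by (rule local_factor[OF p]) blast
    hence "\<And>z. z \<in> ball p r \<Longrightarrow> z \<in> S \<Longrightarrow> z = p" using isolated_S[of p r k n q] by blast
    thus ?thesis using \<open>0 < r\<close> unfolding islimpt_def by (meson centre_in_ball open_ball)
  qed
  thus ?thesis using finite_not_islimpt_in_compact[OF compact_S, of S] by simp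
qed

text \<open>The affine coordinates in the chart \<open>i0\<close> have poles at the points of \<open>S\<close>. Multiplication by
  a Blaschke product with zeros of the right orders clears them, and leaves no common zero.\<close>

lemma lift:
  obtains g :: "complex \<Rightarrow> complex^'m" where
    "\<And>j. unimodular_disc (\<lambda>z. g z $ j)" "\<And>z. z \<in> cball 0 1 \<Longrightarrow> homog_coords (g z) (w z)"
proof -
  \<comment> \<open>One predicate holds all the local data, so that they can be chosen together for
    every point of \<open>S\<close>.\<close>
  define P where "P p k n r q \<longleftrightarrow> 0 < r \<and> ball p r \<subseteq> V k \<inter> ball 0 1 \<and> q holomorphic_on ball p r \<and>
    0 < n \<and> (\<forall>z\<in>ball p r. f k i0 z = (z - p) ^ n * q z \<and> q z \<noteq> 0)" for p k n r q
  have "\<exists>k n r q. P p k n r q" if p: "p \<in> S" for p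
  proof -
    obtain k n r q where "0 < r" "ball p r \<subseteq> V k \<inter> ball 0 1" "q holomorphic_on ball p r"
      "0 < n" "\<And>z. z \<in> ball p r \<Longrightarrow> f k i0 z = (z - p) ^ n * q z"
      "\<And>z. z \<in> ball p r \<Longrightarrow> q z \<noteq> 0"
      by (rule local_factor[OF p]) blast
    thus ?thesis by (intro exI[of _ k] exI[of _ n] exI[of _ r] exI[of _ q]) (simp add: P_def)
  qed
  hence "\<forall>p\<in>S. \<exists>k n r q. P p k n r q" by blast
  then obtain k n r q where "\<forall>p\<in>S. P p (k p) (n p) (r p) (q p)" by metis
  hence r: "\<And>p. p \<in> S \<Longrightarrow> 0 < r p" "\<And>p. p \<in> S \<Longrightarrow> ball p (r p) \<subseteq> V (k p) \<inter> ball 0 1"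
    and q: "\<And>p. p \<in> S \<Longrightarrow> q p holomorphic_on ball p (r p)"
      "\<And>p z. p \<in> S \<Longrightarrow> z \<in> ball p (r p) \<Longrightarrow> f (k p) i0 z = (z - p) ^ n p * q p z"
      "\<And>p z. p \<in> S \<Longrightarrow> z \<in> ball p (r p) \<Longrightarrow> q p z \<noteq> 0"
    unfolding P_def by auto
  have iso: "z = p" if "p \<in> S" "z \<in> ball p (r p)" "z \<in> S" for p z
    by (rule isolated_S[of p "r p" "k p" "n p" "q p" z]) (use that r(2) q(2,3) in auto)
  have SD: "p \<in> ball 0 1" if "p \<in> S" for p using S_subset that by blast
  \<comment> \<open>\<open>b S\<close> carries all the prescribed zeros; \<open>b (S - {p})\<close>
    is the cofactor that does not vanish near \<open>p\<close>.\<close>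
  define b where "b T z = (\<Prod>p\<in>T. blaschke_factor p z ^ n p)" for T z
  have b0: "b T z \<noteq> 0" if "T \<subseteq> S" "z \<in> cball 0 1" "z \<notin> T" for T z
    using that SD blaschke_factor_eq_0_iff finite_subset[OF _ finite_S, of T]
    by (auto simp: b_def)
  have bhol: "b T holomorphic_on ball 0 1" if "T \<subseteq> S" for T
    unfolding b_def using that SD blaschke_factor_holomorphic[OF _ ball_subset_cball]
    by (intro holomorphic_on_prod holomorphic_on_power) auto
  have bcont: "continuous_on (cball 0 1) (b S)"
    unfolding b_def using SD blaschke_factor_continuous
    by (intro continuous_on_prod continuous_on_power) auto
  \<comment> \<open>The power of \<open>z - p\<close> in \<open>b S\<close> cancels against the zero
    of \<open>f (k p) i0\<close>. What remains is this zero-free multiplier, which produces the same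
    lift from the chart \<open>k p\<close>.\<close>
  define c where "c p z = b (S - {p}) z / ((1 - cnj p * z) ^ n p * q p z)" for p z
  define h where "h j z = (if z \<in> S then c z z * f (k z) j z else b S z * f i0 j z)" for j z
  have Dp: "z \<in> cball 0 1" "1 - cnj p * z \<noteq> 0" if "p \<in> S" "z \<in> ball p (r p)" for p z
  proof -
    show "z \<in> cball 0 1" using that r(2) ball_subset_cball by blast
    thus "1 - cnj p * z \<noteq> 0" using blaschke_denom SD that by blast
  qed
  have loc: "h j z = c p z * f (k p) j z" if p: "p \<in> S" and z: "z \<in> ball p (r p)" for p z j
  proof (cases "z = p")
    case False
    hence "z \<notin> S" using iso p z by blast
    have Vz: "w z \<in> chart_domain (k p)" using r(2)[OF p] z unfolding V_def by blast
    have "f i0 j z = f (k p) j z / ((z - p) ^ n p * q p z)"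
      using affine_coord_change[OF Vz, of i0 j] q(2)[OF p z] by (simp add: f_def)
    moreover have "b S z = blaschke_factor p z ^ n p * b (S - {p}) z"
      using p finite_S by (simp add: b_def prod.remove)
    ultimately show ?thesis using \<open>z \<notin> S\<close> False Dp[OF p z] q(3)[OF p z]
      by (simp add: h_def c_def blaschke_factor_def power_divide)
  qed (use p in \<open>simp add: h_def\<close>)
  have c_nz: "c p z \<noteq> 0" if p: "p \<in> S" and z: "z \<in> ball p (r p)" for p z
    using b0[of "S - {p}" z] Dp[OF p z] q(3)[OF p z] iso[OF p z] by (auto simp: c_def)
  have h1: "h j holomorphic_on ball p (r p)" if p: "p \<in> S" for p j
  proof -
    have "f (k p) j holomorphic_on ball p (r p)"
      using holomorphic_on_subset[OF holomorphic_f r(2)[OF p]] .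
    moreover have "b (S - {p}) holomorphic_on ball p (r p)"
      using holomorphic_on_subset[OF bhol] r(2)[OF p] by auto
    ultimately have "(\<lambda>z. c p z * f (k p) j z) holomorphic_on ball p (r p)"
      unfolding c_def using q(1,3) p Dp(2)[OF p] by (intro holomorphic_intros) auto
    thus ?thesis by (rule holomorphic_transform) (metis loc[OF p])
  qed
  have "open (ball 0 1 - S)" using finite_S finite_imp_closed by blast
  have sub: "ball 0 1 - S \<subseteq> V i0 \<inter> ball 0 1" by (auto simp: S_def)
  have h2: "h j holomorphic_on ball 0 1 - S" for j
  proof -
    have "(\<lambda>z. b S z * f i0 j z) holomorphic_on ball 0 1 - S"
      by (intro holomorphic_on_mult holomorphic_on_subset[OF bhol]
            holomorphic_on_subset[OF holomorphic_f sub]) auto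
    thus ?thesis by (rule holomorphic_transform) (simp add: h_def)
  qed
  have h3: "h j holomorphic_on ball 0 1" for j
  proof -
    have "h j holomorphic_on (\<Union>A\<in>insert (ball 0 1 - S) ((\<lambda>p. ball p (r p)) ` S). A)"
      by (rule holomorphic_on_UN_open) (use h1 h2 \<open>open (ball 0 1 - S)\<close> in auto)
    moreover have "(\<Union>A\<in>insert (ball 0 1 - S) ((\<lambda>p. ball p (r p)) ` S). A) = ball 0 1"
      using r by auto
    ultimately show ?thesis by simp
  qed
  have h4: "continuous_on (cball 0 1 - S) (h j)" for j
  proof -
    have "continuous_on (cball 0 1 - S) (\<lambda>z. b S z * f i0 j z)"
      by (intro continuous_on_mult continuous_on_subset[OF bcont] continuous_on_subset[OF continuous_f])
         (auto simp: S_def)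
    thus ?thesis by (rule continuous_on_eq) (simp add: h_def)
  qed
  \<comment> \<open>Continuity inside comes from holomorphy, and continuity at the circle from the
    chart \<open>i0\<close>, whose domain contains the circle.\<close>
  have h5: "continuous_on (cball 0 1) (h j)" for j
  proof -
    have un: "(cball 0 1 - S) \<union> ball 0 1 = cball 0 1" using S_subset by auto
    have "openin (top_of_set (cball 0 1)) (cball 0 1 - S)"
      using finite_S finite_imp_closed by (auto simp: openin_open intro!: exI[of _ "- S"])
    moreover have "openin (top_of_set (cball 0 1)) (ball (0::complex) 1)"
      by (intro open_subset) auto
    ultimately show ?thesis
      using continuous_on_Un_local_open[of "cball 0 1 - S" "ball 0 1" "h j"] h3 h4
      by (simp add: un holomorphic_on_imp_continuous_on)
  qed
  have h6: "cmod (h j z) = 1" if z: "z \<in> sphere 0 1" for j z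
  proof -
    have "z \<notin> S" using z S_subset by auto
    moreover have "cmod (b S z) = 1"
      using norm_blaschke_factor[OF SD z] by (simp add: b_def norm_power flip: prod_norm)
    ultimately show ?thesis using clifford_torus_affine[OF sphere_torus[OF z]]
      by (simp add: h_def norm_mult f_def)
  qed
  have h7: "homog_coords (\<chi> j. h j z) (w z)" if z: "z \<in> cball 0 1" for z
  proof (cases "z \<in> S")
    case True
    hence "z \<in> V (k z)" using r[OF True] by auto
    hence "homog_coords (c z z *s (\<chi> j. f (k z) j z)) (w z)"
      using c_nz[OF True] r[OF True] unfolding f_def V_def
      by (intro homog_coords_cmult homog_coords_affine) auto
    moreover have "c z z *s (\<chi> j. f (k z) j z) = (\<chi> j. h j z)"
      using True by (simp add: h_def vec_eq_iff)
    ultimately show ?thesis by simp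
  next
    case False
    hence "z \<in> V i0" using z by (auto simp: S_def)
    hence "homog_coords (b S z *s (\<chi> j. f i0 j z)) (w z)"
      using b0[of S z] z False unfolding f_def V_def
      by (intro homog_coords_cmult homog_coords_affine) auto
    moreover have "b S z *s (\<chi> j. f i0 j z) = (\<chi> j. h j z)"
      using False by (simp add: h_def vec_eq_iff)
    ultimately show ?thesis by simp
  qed
  show ?thesis
    by (rule that[of "\<lambda>z. \<chi> j. h j z"]) (use h3 h5 h6 h7 in \<open>auto simp: unimodular_disc_def\<close>)
qed

end

section \<open>Unitary matrices\<close>

lemma cinner_add_left: "cinner (u + v) w = cinner u w + cinner v w"
  by (simp add: cinner_def algebra_simps sum.distrib)

lemma cinner_diff_left: "cinner (u - v) w = cinner u w - cinner v w"
  by (simp add: cinner_def algebra_simps sum_subtractf)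

lemma cinner_cmult_left: "cinner (c *s u) w = c * cinner u w"
  by (simp add: cinner_def sum_distrib_left mult.assoc)

lemma cinner_cmult_right: "cinner u (c *s w) = cnj c * cinner u w"
  by (simp add: cinner_def sum_distrib_left mult_ac)

lemma cnj_cinner: "cnj (cinner u v) = cinner v u"
  by (simp add: cinner_def mult.commute)

lemma cinner_self: "cinner x x = of_real ((norm x)\<^sup>2)"
proof -
  have "(norm x)\<^sup>2 = (\<Sum>i\<in>UNIV. (cmod (x $ i))\<^sup>2)"
    unfolding norm_vec_def L2_set_def by (rule real_sqrt_pow2) (simp add: sum_nonneg)
  thus ?thesis unfolding cinner_def by (simp only: of_real_sum complex_norm_square)
qed

lemma cinner_add_right: "cinner w (u + v) = cinner w u + cinner w v"
  by (simp add: cinner_def algebra_simps sum.distrib)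

lemma cinner_diff_right: "cinner w (u - v) = cinner w u - cinner w v"
  by (simp add: cinner_def algebra_simps sum_subtractf)

lemma cinner_self_eq_0 [simp]: "cinner x x = 0 \<longleftrightarrow> x = 0"
  by (simp add: cinner_self)

definition adjoint_matrix :: "complex^'n^'n::finite \<Rightarrow> complex^'n^'n" where
  "adjoint_matrix A = map_matrix cnj (transpose A)"

lemma adjoint_matrix_nth [simp]: "adjoint_matrix A $ i $ j = cnj (A $ j $ i)"
  by (simp add: adjoint_matrix_def map_matrix_def transpose_def)

lemma unitary_matrix_iff_left: "unitary_matrix A \<longleftrightarrow> adjoint_matrix A ** A = mat 1"
  unfolding unitary_matrix_def adjoint_matrix_def using matrix_left_right_inverse[of A "map_matrix cnj (transpose A)"] by blast

lemma unitary_matrix_iff_right: "unitary_matrix A \<longleftrightarrow> A ** adjoint_matrix A = mat 1"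
  unfolding unitary_matrix_def adjoint_matrix_def using matrix_left_right_inverse[of A "map_matrix cnj (transpose A)"] by blast

lemma unitary_matrix_columns:
  "unitary_matrix A \<longleftrightarrow> (\<forall>k l. cinner (column l A) (column k A) = (if k = l then 1 else 0))"
proof -
  have "(adjoint_matrix A ** A) $ k $ l = cinner (column l A) (column k A)" for k l
    by (simp add: matrix_matrix_mult_def cinner_def column_def mult.commute)
  thus ?thesis unfolding unitary_matrix_iff_left by (simp add: vec_eq_iff mat_def)
qed

lemma adjoint_matrix_mult: "adjoint_matrix (A ** B) = adjoint_matrix B ** adjoint_matrix A"
  by (simp add: vec_eq_iff matrix_matrix_mult_def mult.commute)

lemma adjoint_adjoint_matrix [simp]: "adjoint_matrix (adjoint_matrix A) = A"
  by (simp add: vec_eq_iff)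

lemma unitary_matrix_mult:
  assumes "unitary_matrix A" "unitary_matrix B"
  shows "unitary_matrix (A ** B)"
proof -
  have "adjoint_matrix (A ** B) ** (A ** B) = adjoint_matrix B ** (adjoint_matrix A ** A) ** B"
    by (simp add: adjoint_matrix_mult matrix_mul_assoc)
  thus ?thesis using assms by (simp add: unitary_matrix_iff_left)
qed

lemma unitary_matrix_adjoint: "unitary_matrix A \<Longrightarrow> unitary_matrix (adjoint_matrix A)"
  using unitary_matrix_iff_left[of "adjoint_matrix A"] unitary_matrix_iff_right[of A] by simp

lemma adjoint_matrix_vector:
  "cinner (A *v u) v = cinner u (adjoint_matrix A *v v)"
proof -
  have "cinner (A *v u) v = (\<Sum>i\<in>UNIV. \<Sum>j\<in>UNIV. A $ i $ j * u $ j * cnj (v $ i))"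
    by (simp add: cinner_def matrix_vector_mult_def sum_distrib_right)
  also have "\<dots> = (\<Sum>j\<in>UNIV. \<Sum>i\<in>UNIV. A $ i $ j * u $ j * cnj (v $ i))"
    by (rule sum.swap)
  also have "\<dots> = cinner u (adjoint_matrix A *v v)"
    by (simp add: cinner_def matrix_vector_mult_def sum_distrib_left mult_ac)
  finally show ?thesis .
qed

lemma unitary_matrix_cancel:
  assumes "unitary_matrix A"
  shows "adjoint_matrix A *v (A *v u) = u" "A *v (adjoint_matrix A *v u) = u"
  using assms unitary_matrix_iff_left[of A] unitary_matrix_iff_right[of A]
  by (auto simp: matrix_vector_mul_assoc)

lemma unitary_matrix_cinner:
  assumes "unitary_matrix A"
  shows "cinner (A *v u) (A *v v) = cinner u v"
  by (simp add: adjoint_matrix_vector unitary_matrix_cancel[OF assms])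

lemma unitary_matrix_det_nonzero:
  assumes "unitary_matrix A"
  shows "det A \<noteq> 0"
proof -
  have "det (adjoint_matrix A) * det A = 1"
    using assms det_mul[of "adjoint_matrix A" A] by (simp add: unitary_matrix_iff_left)
  thus ?thesis by auto
qed

lemma real_unitary_det:
  assumes "unitary_matrix Q" "\<And>i j. Q $ i $ j \<in> \<real>"
  shows "(det Q)\<^sup>2 = 1"
proof -
  have "adjoint_matrix Q = transpose Q"
    using assms(2) by (simp add: vec_eq_iff transpose_def Reals_cnj_iff)
  hence "det (transpose Q) * det Q = 1"
    using assms(1) det_mul[of "transpose Q" Q] by (simp add: unitary_matrix_iff_left)
  thus ?thesis by (simp add: power2_eq_square)
qed

section \<open>Rotations between unit vectors and continuous unitary frames\<close>

text \<open>Multiplication by \<open>-1\<close> followed by the complex reflection that maps \<open>-a\<close> to \<open>b\<close>. Unlike a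
  reflection that maps \<open>a\<close> to \<open>b\<close>, it is continuous at \<open>a = b\<close>.\<close>

definition unit_rotation :: "complex^'n \<Rightarrow> complex^'n \<Rightarrow> complex^'n^'n::finite" where
  "unit_rotation a b =
     (\<chi> i j. (a $ i + b $ i) * cnj (a $ j + b $ j) / (1 + cinner a b) - (if i = j then 1 else 0))"

lemma unit_rotation_vector:
  "unit_rotation a b *v x = (cinner x (a + b) / (1 + cinner a b)) *s (a + b) - x"
proof -
  have "(unit_rotation a b *v x) $ i = ((cinner x (a + b) / (1 + cinner a b)) *s (a + b) - x) $ i" for i
  proof -
    have "(unit_rotation a b *v x) $ i =
      (\<Sum>j\<in>UNIV. (a $ i + b $ i) / (1 + cinner a b) * (x $ j * cnj (a $ j + b $ j))) -
      (\<Sum>j\<in>UNIV. if i = j then x $ j else 0)"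
      unfolding unit_rotation_def matrix_vector_mult_def sum_subtractf[symmetric]
      by (simp only: vec_lambda_beta) (intro sum.cong, auto simp: algebra_simps add_divide_distrib)
    also have "\<dots> = ((cinner x (a + b) / (1 + cinner a b)) *s (a + b) - x) $ i"
      unfolding sum_distrib_left[symmetric] by (simp add: cinner_def mult_ac add_divide_distrib ring_distribs)
    finally show ?thesis .
  qed
  thus ?thesis by (simp add: vec_eq_iff)
qed

lemma matrix_vector_axis: "A *v axis k 1 = column k A"
proof -
  have "(A *v axis k 1) $ i = (\<Sum>j\<in>UNIV. if j = k then A $ i $ j else 0)" for i
    unfolding matrix_vector_mult_def vec_lambda_beta by (rule sum.cong) (auto simp: axis_def)
  thus ?thesis by (simp add: vec_eq_iff column_def)
qed

lemma cinner_axis_right: "cinner u (axis k 1) = u $ k"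
proof -
  have "cinner u (axis k 1) = (\<Sum>i\<in>UNIV. if i = k then u $ i else 0)"
    unfolding cinner_def by (rule sum.cong) (auto simp: axis_def)
  thus ?thesis by simp
qed

lemma unitary_matrixI:
  assumes "\<And>u v. cinner (A *v u) (A *v v) = cinner u v"
  shows "unitary_matrix A"
  unfolding unitary_matrix_columns matrix_vector_axis[symmetric] assms
  by (simp add: cinner_axis_right) (simp add: axis_def)

text \<open>With \<open>s = a + b\<close> and \<open>d = 1 + cinner a b\<close>, inner products are
  preserved because \<open>cinner s s = d + cnj d\<close>, and \<open>a\<close> goes to
  \<open>s - a\<close> because \<open>cinner a s = d\<close>.\<close>

lemma unit_rotation_unitary:
  assumes "cinner a a = 1" "cinner b b = 1" "cinner a b \<noteq> -1"
  shows "unitary_matrix (unit_rotation a b)" "unit_rotation a b *v a = b"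
proof -
  define s d where "s = a + b" and "d = 1 + cinner a b"
  have d0: "d \<noteq> 0" using assms(3) by (auto simp: d_def add_eq_0_iff)
  have cnjd: "cnj d = 1 + cinner b a" by (simp add: d_def cnj_cinner)
  have as: "cinner a s = d" and ss: "cinner s s = d + cnj d"
    using assms by (auto simp: s_def d_def cnj_cinner cinner_add_left cinner_add_right)
  show "unit_rotation a b *v a = b"
    using d0 as by (simp add: unit_rotation_vector s_def d_def)
  have alg: "x / d * (y / cnj d * s) - x / d * y - (y / cnj d * x - c) =
      x * y * (s / (d * cnj d) - 1 / d - 1 / cnj d) + c" for x y s c
    using d0 by (simp add: field_simps)
  show "unitary_matrix (unit_rotation a b)"
  proof (rule unitary_matrixI)
    fix u v
    have "cinner (unit_rotation a b *v u) (unit_rotation a b *v v) =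
      cinner ((cinner u s / d) *s s - u) ((cinner v s / d) *s s - v)"
      by (simp add: unit_rotation_vector s_def d_def)
    also have "\<dots> = cinner u s / d * (cnj (cinner v s) / cnj d * cinner s s)
        - cinner u s / d * cnj (cinner v s) - (cnj (cinner v s) / cnj d * cinner u s - cinner u v)"
      by (simp add: cinner_diff_left cinner_diff_right cinner_cmult_left cinner_cmult_right right_diff_distrib
          cnj_cinner mult_ac)
    also have "\<dots> = cinner u s * cnj (cinner v s) * (cinner s s / (d * cnj d) - 1 / d - 1 / cnj d) + cinner u v"
      by (rule alg)
    also have "cinner s s / (d * cnj d) - 1 / d - 1 / cnj d = 0"
      using d0 by (simp add: ss field_simps)
    finally show "cinner (unit_rotation a b *v u) (unit_rotation a b *v v) = cinner u v" by simp
  qed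
qed

text \<open>In the case excluded above \<open>b\<close> is \<open>- a\<close>; rotating
  \<open>a\<close> to \<open>- b\<close> and changing the sign of the matrix avoids the zero
  denominator.\<close>

lemma exists_unitary_column:
  assumes "cinner a a = 1" "cinner b b = (1::complex)"
  obtains U where "unitary_matrix U" "U *v a = b"
proof (cases "cinner a b = -1")
  case True
  have "cinner (- b) (- b) = 1" "cinner a (- b) \<noteq> -1"
    using True assms by (auto simp: cinner_def sum_negf)
  hence "unitary_matrix (unit_rotation a (- b))" "unit_rotation a (- b) *v a = - b"
    using unit_rotation_unitary[of a "- b"] assms(1) by auto
  hence "unitary_matrix (- unit_rotation a (- b))" "(- unit_rotation a (- b)) *v a = b"
    by (auto simp: unitary_matrix_columns column_def cinner_def matrix_vector_mult_def sum_negf vec_eq_iff)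
  thus ?thesis using that by blast
next
  case False
  show ?thesis by (rule that) (rule unit_rotation_unitary[OF assms False])+
qed

text \<open>The unit vectors \<open>u (t * z)\<close> for successive values of \<open>t\<close> on a fine subdivision of \<open>[0,1]\<close>
  are close to each other, and are mapped to each other by \<^const>\<open>unit_rotation\<close>.\<close>

lemma continuous_unitary_frame:
  fixes u :: "complex \<Rightarrow> complex^'n::finite"
  assumes cont: "continuous_on (cball 0 1) u" and unit: "\<And>z. z \<in> cball 0 1 \<Longrightarrow> cinner (u z) (u z) = 1"
    and e: "cinner e e = 1"
  obtains U where "continuous_on (cball 0 1) U" "\<And>z. z \<in> cball 0 1 \<Longrightarrow> unitary_matrix (U z)"
    "\<And>z. z \<in> cball 0 1 \<Longrightarrow> U z *v e = u z"
proof -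
  \<comment> \<open>Unit vectors with inner product \<open>-1\<close> are at distance 2, so nearby
    ones keep the denominator of \<open>unit_rotation\<close> nonzero.\<close>
  have close: "cinner a b \<noteq> -1" if "cinner a a = 1" "cinner b b = 1" "dist a b < 1" for a b :: "complex^'n"
  proof
    assume "cinner a b = -1"
    moreover from this have "cinner b a = -1" using cnj_cinner[of a b] by simp
    moreover have "cinner (a - b) (a - b) = cinner a a + cinner b b - cinner a b - cinner b a"
      by (simp add: cinner_def algebra_simps sum_subtractf sum.distrib)
    ultimately have "complex_of_real ((norm (a - b))\<^sup>2) = of_real 4"
      using that unfolding cinner_self[of "a - b"] by simp
    hence "(norm (a - b))\<^sup>2 = 4" by (simp only: of_real_eq_iff)
    moreover have "(norm (a - b))\<^sup>2 < 1" using that(3) by (simp add: dist_norm abs_square_less_1)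
    ultimately show False by simp
  qed
  have "uniformly_continuous_on (cball 0 1) u"
    by (rule compact_uniformly_continuous[OF cont compact_cball])
  then obtain \<delta> where \<delta>: "\<delta> > 0"
    "\<And>x y. x \<in> cball 0 1 \<Longrightarrow> y \<in> cball 0 1 \<Longrightarrow> dist x y < \<delta> \<Longrightarrow> dist (u x) (u y) < 1"
    unfolding uniformly_continuous_on_def by (metis zero_less_one)
  obtain N :: nat where N: "N > 0" "1 / real N < \<delta>"
    using \<delta>(1) by (metis nat_approx_posE zero_less_Suc inverse_eq_divide of_nat_Suc)
  have scale: "of_real t * z \<in> cball 0 1" if "0 \<le> t" "t \<le> 1" "z \<in> cball 0 1" for t and z :: complex
    using that mult_mono[of t 1 "cmod z" 1] by (simp add: norm_mult)
  \<comment> \<open>Induction along the radii: the \<open>m\<close>-th matrix frames the values of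
    \<open>u\<close> on the disc shrunk by \<open>m / N\<close>. It starts with a constant matrix at
    the centre, and \<open>m = N\<close> gives the claim.\<close>
  have "\<exists>U. continuous_on (cball 0 1) U \<and>
      (\<forall>z\<in>cball 0 1. unitary_matrix (U z) \<and> U z *v e = u (of_real (real m / real N) * z))"
    if "m \<le> N" for m
    using that
  proof (induction m)
    case 0
    obtain U where "unitary_matrix U" "U *v e = u 0"
      using exists_unitary_column[of e "u 0"] e unit by auto
    thus ?case by (intro exI[of _ "\<lambda>_. U"]) auto
  next
    case (Suc m)
    then obtain U where U: "continuous_on (cball 0 1) U"
      "\<And>z. z \<in> cball 0 1 \<Longrightarrow> unitary_matrix (U z)"
      "\<And>z. z \<in> cball 0 1 \<Longrightarrow> U z *v e = u (of_real (real m / real N) * z)" by force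
    define a b where "a z = u (of_real (real m / real N) * z)"
      and "b z = u (of_real (real (Suc m) / real N) * z)" for z
    have pt: "of_real (real k / real N) * z \<in> cball 0 1" if "k \<le> N" "z \<in> cball 0 1" for k and z :: complex
      using that N(1) by (intro scale) auto
    have unit': "cinner (a z) (a z) = 1" "cinner (b z) (b z) = 1" if "z \<in> cball 0 1" for z
      unfolding a_def b_def by (rule unit[OF pt]; use that Suc.prems in simp)+
    have nz: "cinner (a z) (b z) \<noteq> -1" if z: "z \<in> cball 0 1" for z
    proof (rule close[OF unit'[OF z]])
      have "of_real (real m / real N) * z - of_real (real (Suc m) / real N) * z = - (of_real (1 / real N) * z)"
        by (simp add: algebra_simps add_divide_distrib)
      hence "dist (of_real (real m / real N) * z) (of_real (real (Suc m) / real N) * z) = 1 / real N * cmod z"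
        by (simp only: dist_norm norm_minus_cancel norm_mult norm_of_real) simp
      also have "\<dots> \<le> 1 / real N * 1" using z by (intro mult_left_mono) auto
      finally show "dist (a z) (b z) < 1"
        unfolding a_def b_def using z Suc.prems N(2) by (intro \<delta>(2) pt) auto
    qed
    have "continuous_on (cball 0 1) (\<lambda>z. u (of_real (real k / real N) * z))" if "k \<le> N" for k
      by (rule continuous_on_compose2[OF cont]) (intro continuous_intros, use pt[OF that] in blast)
    from this[of m] this[of "Suc m"] have "continuous_on (cball 0 1) a" "continuous_on (cball 0 1) b"
      unfolding a_def b_def using Suc.prems by simp_all
    hence "continuous_on (cball 0 1) (\<lambda>z. unit_rotation (a z) (b z) ** U z)"
      using U(1) nz unfolding unit_rotation_def matrix_matrix_mult_def cinner_def
      by (intro continuous_intros) (auto simp: add_eq_0_iff)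
    moreover have "\<forall>z\<in>cball 0 1. unitary_matrix (unit_rotation (a z) (b z) ** U z)
      \<and> (unit_rotation (a z) (b z) ** U z) *v e = b z"
      using unit_rotation_unitary[OF unit' nz] U(2,3)
      by (auto simp: matrix_vector_mul_assoc[symmetric] a_def intro!: unitary_matrix_mult)
    ultimately show ?case unfolding b_def by (intro exI conjI)
  qed
  from this[of N] N(1) that show ?thesis by auto
qed

section \<open>Degrees of loops\<close>

text \<open>\<open>H\<close> has a continuous logarithm on the disc and thus no winding; all of it
  comes from \<open>\<zeta> ^ n\<close>.\<close>

lemma circle_degree_monomial:
  assumes H: "continuous_on (cball 0 1) H" "\<And>z. z \<in> cball 0 1 \<Longrightarrow> H z \<noteq> 0"
    and f: "\<And>\<zeta>. \<zeta> \<in> sphere 0 1 \<Longrightarrow> f \<zeta> = \<zeta> ^ n * H \<zeta>"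
  shows "circle_degree f = of_nat n"
proof -
  obtain k where k: "continuous_on (cball 0 1) k" "\<And>z. z \<in> cball 0 1 \<Longrightarrow> H z = exp (k z)"
    using continuous_logarithm_on_cball[OF H] by metis
  define c where "c t = exp (2 * of_real pi * \<i> * complex_of_real t)" for t
  have c: "circlepath 0 1 = c" by (simp add: fun_eq_iff circlepath c_def)
  have c1: "cmod (c t) = 1" for t
    using norm_exp_i_times[of "2 * pi * t"] by (simp add: c_def mult_ac)
  \<comment> \<open>A continuous logarithm of the loop. The term with \<open>k\<close> has equal
    values at both ends because \<open>c\<close> is closed, so the ends differ by \<open>n\<close>
    full turns.\<close>
  define p where "p t = of_nat n * (2 * of_real pi * \<i> * complex_of_real t) + k (c t)" for t
  have "path p"
    unfolding path_def p_def c_def[abs_def]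
    by (intro continuous_intros continuous_on_compose2[OF k(1)]) (use c1 in \<open>auto simp: c_def\<close>)
  moreover have "f \<circ> circlepath 0 1 = exp \<circ> p"
    using c1 by (simp add: fun_eq_iff c f k(2) p_def exp_add exp_of_nat_mult c_def[symmetric])
  moreover have "c 1 = c 0" by (simp add: c_def exp_eq_1)
  hence "pathfinish p - pathstart p = of_nat n * (2 * of_real pi * \<i>)"
    by (simp add: pathfinish_def pathstart_def p_def)
  ultimately show ?thesis
    unfolding circle_degree_def using winding_number_compose_exp[of p] by simp
qed

text \<open>On the unit circle \<open>z - a = z * (1 - a * cnj z)\<close>, and the second factor extends to the disc
  without zeros.\<close>

lemma blaschke_product_monomial:
  assumes "\<And>j. j \<in> {1..m} \<Longrightarrow> a j \<in> ball 0 1"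
  obtains K where "continuous_on (cball 0 1) K" "\<And>z. z \<in> cball 0 1 \<Longrightarrow> K z \<noteq> 0"
    "\<And>\<zeta>. \<zeta> \<in> sphere 0 1 \<Longrightarrow> blaschke_product \<theta> m a \<zeta> = \<zeta> ^ m * K \<zeta>"
proof -
  \<comment> \<open>\<open>K\<close> need not be holomorphic; continuity suffices for the winding
    number.\<close>
  define K where "K z = exp (\<i> * of_real \<theta>) *
    (\<Prod>j=1..m. (1 - a j * cnj z) / (1 - cnj (a j) * z))" for z
  have d: "1 - cnj (a j) * z \<noteq> 0" "1 - a j * cnj z \<noteq> 0" if "j \<in> {1..m}" "z \<in> cball 0 1" for j z
  proof -
    show "1 - cnj (a j) * z \<noteq> 0" using blaschke_denom assms that by blast
    hence "cnj (1 - cnj (a j) * z) \<noteq> 0" by (metis complex_cnj_zero_iff)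
    thus "1 - a j * cnj z \<noteq> 0" by simp
  qed
  have "continuous_on (cball 0 1) K"
    unfolding K_def using d by (intro continuous_intros) auto
  moreover have "K z \<noteq> 0" if "z \<in> cball 0 1" for z
    using d that by (simp add: K_def)
  moreover have "blaschke_product \<theta> m a \<zeta> = \<zeta> ^ m * K \<zeta>" if "\<zeta> \<in> sphere 0 1" for \<zeta>
  proof -
    have "\<zeta> * cnj \<zeta> = 1" using that by (simp add: complex_norm_square[symmetric])
    hence "\<zeta> - a j = \<zeta> * (1 - a j * cnj \<zeta>)" for j by (simp add: algebra_simps)
    hence "(\<Prod>j=1..m. (\<zeta> - a j) / (1 - cnj (a j) * \<zeta>)) =
        (\<Prod>j=1..m. \<zeta> * ((1 - a j * cnj \<zeta>) / (1 - cnj (a j) * \<zeta>)))"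
      by (intro prod.cong) (simp_all only: times_divide_eq_right)
    also have "\<dots> = \<zeta> ^ m * (\<Prod>j=1..m. (1 - a j * cnj \<zeta>) / (1 - cnj (a j) * \<zeta>))"
      unfolding prod.distrib by simp
    finally show ?thesis by (simp add: blaschke_product_def K_def)
  qed
  ultimately show ?thesis by (rule that)
qed

section \<open>Tangent spaces of projective space and of the torus\<close>

text \<open>For a unit vector \<open>x\<close> this sends \<open>x\<close> to \<open>y\<close> and
  the complement of \<open>x\<close> to 0, so tangent vectors at \<open>[x]\<close> correspond to
  vectors \<open>y\<close> orthogonal to \<open>x\<close>.\<close>

definition rank_one :: "complex^'m \<Rightarrow> complex^'m \<Rightarrow> complex^'m^'m::finite" where
  "rank_one y x = (\<chi> i j. y $ i * cnj (x $ j))"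

lemma rank_one_apply: "rank_one y x *v v = cinner v x *s y"
  by (simp add: rank_one_def matrix_vector_mult_def cinner_def vec_eq_iff sum_distrib_left mult_ac)

lemma cinner_rank_one: "cinner_matrix (rank_one y x) (rank_one y' x') = cinner y y' * cinner x' x"
  unfolding cinner_matrix_def cinner_def sum_product by (simp add: rank_one_def mult_ac)

lemma rank_one_inj:
  assumes "cinner x x = 1" "rank_one y x = rank_one y' x"
  shows "y = y'"
proof -
  have "rank_one y x *v x = rank_one y' x *v x" by (simp only: assms(2))
  thus ?thesis by (simp add: rank_one_apply assms(1))
qed

text \<open>Rewrites a tangent vector given over another representative of the point as one over the
  chosen unit vector.\<close>

lemma rank_one_cmult_right: "rank_one y (c *s x) = rank_one (cnj c *s y) x"
  by (simp add: rank_one_def vec_eq_iff mult_ac)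

lemma proj_deriv_rank_one:
  "proj_deriv x v = rank_one (inverse (cinner x x) *s (v - (cinner v x / cinner x x) *s x)) x"
  by (simp add: proj_deriv_def rank_one_def vec_eq_iff divide_inverse algebra_simps)

lemma cinner_scaleR_left: "cinner (t *\<^sub>R u) v = of_real t * cinner u v"
  by (simp only: cinner_def vector_scaleR_component sum_distrib_left mult_scaleR_left)
     (simp only: scaleR_conv_of_real)

lemma tangent_space_UNIV:
  assumes x: "homog_coords x p" "cinner x x = 1"
  shows "tangent_space_cproj UNIV p = {rank_one y x | y. cinner y x = 0}"
proof (intro equalityI subsetI)
  fix M assume "M \<in> tangent_space_cproj UNIV p"
  then obtain c v where c: "M = proj_deriv (c 0) v" "homog_coords (c (0::real)) p"
    unfolding tangent_space_cproj_def by blast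
  obtain l where l: "l \<noteq> 0" "c 0 = l *s x"
    by (rule homog_coords_unique[OF x(1) c(2)]) blast
  define y where "y = inverse (cinner (c 0) (c 0)) *s (v - (cinner v (c 0) / cinner (c 0) (c 0)) *s c 0)"
  have "c 0 \<noteq> 0" using c by (simp add: homog_coords_def)
  hence "cinner y (c 0) = 0" by (simp add: y_def cinner_cmult_left cinner_diff_left)
  hence "cinner y x = 0" using l by (simp add: cinner_cmult_right)
  moreover have "M = rank_one (cnj l *s y) x"
    unfolding c(1) proj_deriv_rank_one y_def[symmetric] unfolding l(2) rank_one_cmult_right ..
  ultimately show "M \<in> {rank_one y x | y. cinner y x = 0}"
    by (auto simp: cinner_cmult_left intro!: exI[of _ "cnj l *s y"])
next
  fix M assume "M \<in> {rank_one y x | y. cinner y x = 0}"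
  then obtain y where y: "M = rank_one y x" "cinner y x = 0" by blast
  \<comment> \<open>This line never meets 0, because its inner product with \<open>x\<close> is
    constantly 1.\<close>
  define c where "c t = x + t *\<^sub>R y" for t :: real
  have "c t \<noteq> 0" for t
  proof
    assume "c t = 0"
    moreover have "cinner (c t) x = 1"
      using x y by (simp add: c_def cinner_add_left cinner_scaleR_left)
    ultimately show False by (simp add: cinner_def)
  qed
  hence "\<exists>q\<in>UNIV. homog_coords (c t) q" for t by (auto simp: homog_coords_def)
  moreover have "(c has_vector_derivative y) (at 0)"
    unfolding c_def by (auto intro!: derivative_eq_intros)
  moreover have "M = proj_deriv (c 0) y" "homog_coords (c 0) p"
    using x y by (simp_all add: proj_deriv_rank_one c_def)
  ultimately show "M \<in> tangent_space_cproj UNIV p"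
    unfolding tangent_space_cproj_def mem_Collect_eq
    by (intro exI[of _ c] exI[of _ y] conjI allI) simp_all
qed

text \<open>The torus consists of the points \<open>[exp (\<i> * t i) * x i]\<^sub>i\<close>, so its tangent vectors are given by
  \<open>(\<i> * t i * x i)\<^sub>i\<close>; the condition on the sum is orthogonality to \<open>x\<close>.\<close>

lemma tangent_space_torus:
  fixes x :: "complex^'m::finite"
  assumes x: "homog_coords x p" "cinner x x = 1" and p: "p \<in> clifford_torus"
  shows "tangent_space_cproj clifford_torus p =
    {rank_one (\<chi> i. \<i> * of_real (t i) * x $ i) x | t. (\<Sum>i\<in>UNIV. t i) = 0}" (is "_ = ?R")
proof (intro equalityI subsetI)
  fix M assume "M \<in> tangent_space_cproj clifford_torus p"
  then obtain c v where c: "M = proj_deriv (c 0) v" "homog_coords (c (0::real)) p"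
    "\<And>t. \<exists>q\<in>clifford_torus. homog_coords (c t) q" "(c has_vector_derivative v) (at 0)"
    unfolding tangent_space_cproj_def by blast
  obtain l where l: "l \<noteq> 0" "c 0 = l *s x"
    by (rule homog_coords_unique[OF x(1) c(2)]) blast
  have rank_one_c0: "rank_one y (c 0) = rank_one (cnj l *s y) x" for y
    unfolding l(2) rank_one_cmult_right ..
  have eq: "(cmod (c t $ i))\<^sup>2 = (cmod (c t $ j))\<^sup>2" for t i j
  proof -
    obtain q where "q \<in> clifford_torus" "homog_coords (c t) q" using c(3)[of t] by blast
    thus ?thesis using clifford_torus_iff[of "c t" q] by simp
  qed
  have c0: "c 0 $ i \<noteq> 0" for i using clifford_torus_nonzero[OF c(2) p] .
  have der: "((\<lambda>t. (cmod (c t $ i))\<^sup>2) has_real_derivative 2 * Re (v $ i * cnj (c 0 $ i))) (at 0)" for i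
  proof -
    have "((\<lambda>t. c t $ i) has_vector_derivative v $ i) (at 0)"
      using bounded_linear.has_vector_derivative[OF bounded_linear_vec_nth c(4)] .
    hence d: "((\<lambda>t. Re (c t $ i)) has_real_derivative Re (v $ i)) (at 0)"
      "((\<lambda>t. Im (c t $ i)) has_real_derivative Im (v $ i)) (at 0)"
      unfolding has_real_derivative_iff_has_vector_derivative
      by (rule bounded_linear.has_vector_derivative[OF bounded_linear_Re]
          bounded_linear.has_vector_derivative[OF bounded_linear_Im])+
    show ?thesis unfolding cmod_power2
      using DERIV_add[OF DERIV_power[OF d(1), of 2] DERIV_power[OF d(2), of 2]]
      by (simp add: algebra_simps)
  qed
  \<comment> \<open>The coordinates of the curve have equal moduli at every time, so their squared
    moduli have equal derivatives.\<close>
  have Re_eq: "Re (v $ i * cnj (c 0 $ i)) = Re (v $ j * cnj (c 0 $ j))" for i j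
  proof -
    have "(\<lambda>t. (cmod (c t $ i))\<^sup>2) = (\<lambda>t. (cmod (c t $ j))\<^sup>2)" by (rule ext) (rule eq)
    hence "((\<lambda>t. (cmod (c t $ i))\<^sup>2) has_real_derivative 2 * Re (v $ j * cnj (c 0 $ j))) (at 0)"
      using der[of j] by (simp only:)
    from DERIV_unique[OF der[of i] this] show ?thesis by simp
  qed
  define i0 where "i0 = (SOME i :: 'm. True)"
  define r where "r = (cmod (c 0 $ i0))\<^sup>2"
  have r: "(cmod (c 0 $ i))\<^sup>2 = r" for i unfolding r_def by (rule eq)
  have r0: "r > 0" using c0[of i0] by (simp add: r_def)
  \<comment> \<open>Relative to \<open>c 0 $ i\<close> the velocity has the radial part
    \<open>a / r\<close>, common to all coordinates, and the angular part
    \<open>\<phi> i / r\<close>.\<close>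
  define a where "a = Re (v $ i0 * cnj (c 0 $ i0))"
  define \<phi> where "\<phi> i = Im (v $ i * cnj (c 0 $ i))" for i
  define N where "N = real CARD('m)"
  have N0: "N > 0" by (simp add: N_def)
  define \<phi>' where "\<phi>' = (\<Sum>i\<in>UNIV. \<phi> i) / N"
  have cc: "c 0 $ i * cnj (c 0 $ i) = of_real r" for i
    unfolding r[of i, symmetric] by (rule complex_norm_square[symmetric])
  have vc: "v $ i * cnj (c 0 $ i) = of_real a + \<i> * of_real (\<phi> i)" for i
    using Re_eq[of i i0] by (simp add: complex_eq_iff a_def \<phi>_def)
  have vi: "v $ i = (of_real a + \<i> * of_real (\<phi> i)) * c 0 $ i / of_real r" for i
  proof -
    have "v $ i * of_real r = v $ i * cnj (c 0 $ i) * c 0 $ i"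
      unfolding cc[of i, symmetric] by (simp add: mult_ac)
    thus ?thesis using r0 unfolding vc by (simp add: field_simps)
  qed
  have s1: "cinner (c 0) (c 0) = of_real (N * r)" by (simp add: cinner_def cc N_def)
  have s2: "cinner v (c 0) = of_real N * (of_real a + \<i> * of_real \<phi>')"
    using N0 by (simp add: cinner_def vc sum.distrib sum_distrib_left[symmetric] N_def \<phi>'_def field_simps)
  \<comment> \<open>Projection orthogonal to \<open>c 0\<close> removes the radial part and the mean
    \<open>\<phi>'\<close> of the angular parts. One \<open>r\<close> comes from \<open>vi\<close>,
    \<open>N * r\<close> is the squared norm of \<open>c 0\<close>, and \<open>(cmod l)^2\<close>
    comes from passing to \<open>x\<close>.\<close>
  define t where "t i = (cmod l)\<^sup>2 * (\<phi> i - \<phi>') / (N * r * r)" for i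
  have t: "(\<Sum>i\<in>UNIV. t i) = 0"
    using N0 unfolding t_def sum_divide_distrib[symmetric] sum_distrib_left[symmetric]
    by (simp add: sum_subtractf \<phi>'_def N_def)
  have "cnj l *s (inverse (cinner (c 0) (c 0)) *s (v - (cinner v (c 0) / cinner (c 0) (c 0)) *s c 0)) =
      (\<chi> i. \<i> * of_real (t i) * x $ i)"
  proof -
    have "cnj l * (inverse (of_real (N * r)) *
        (v $ i - of_real N * (of_real a + \<i> * of_real \<phi>') / of_real (N * r) * c 0 $ i)) =
        \<i> * of_real (t i) * x $ i" for i
    proof -
      have *: "v $ i - of_real N * (of_real a + \<i> * of_real \<phi>') / of_real (N * r) * c 0 $ i =
        \<i> * of_real ((\<phi> i - \<phi>') / r) * c 0 $ i"
        using N0 r0 unfolding vi by (simp add: field_simps)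
      have cl: "cnj l * c 0 $ i = of_real ((cmod l)\<^sup>2) * x $ i"
        using complex_norm_square[of l] by (simp add: l(2) mult_ac)
      have "cnj l * (inverse (of_real (N * r)) * (\<i> * of_real ((\<phi> i - \<phi>') / r) * c 0 $ i)) =
          inverse (of_real (N * r)) * \<i> * of_real ((\<phi> i - \<phi>') / r) * (cnj l * c 0 $ i)"
        by (simp only: mult_ac)
      also have "\<dots> = inverse (of_real (N * r)) * \<i> * of_real ((\<phi> i - \<phi>') / r) *
          (of_real ((cmod l)\<^sup>2) * x $ i)"
        unfolding cl ..
      also have "\<dots> = \<i> * of_real (t i) * x $ i"
        by (simp add: t_def divide_inverse mult_ac)
      finally show ?thesis unfolding * .
    qed
    thus ?thesis unfolding s1 s2
      by (simp only: vec_eq_iff vector_component vec_lambda_beta simp_thms)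
  qed
  hence "M = rank_one (\<chi> i. \<i> * of_real (t i) * x $ i) x"
    unfolding c(1) proj_deriv_rank_one rank_one_c0 by simp
  thus "M \<in> ?R" using t by blast
next
  fix M assume "M \<in> ?R"
  then obtain t where t: "M = rank_one (\<chi> i. \<i> * of_real (t i) * x $ i) x" "(\<Sum>i\<in>UNIV. t i) = 0" by blast
  define v where "v = (\<chi> i. \<i> * of_real (t i) * x $ i)"
  \<comment> \<open>Rotating the coordinates independently keeps their moduli, so the curve stays in
    the torus; its velocity at 0 is \<open>v\<close>.\<close>
  define c where "c s = (\<chi> i. exp (\<i> * of_real (t i) * of_real s) * x $ i)" for s :: real
  have nrm: "cmod (c s $ i) = cmod (x $ i)" for s i
    using norm_exp_i_times[of "t i * s"] by (simp add: c_def norm_mult mult.assoc)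
  have c1: "\<exists>q\<in>clifford_torus. homog_coords (c s) q" for s
  proof -
    obtain i where "x $ i \<noteq> 0" using x(1) by (auto simp: homog_coords_def vec_eq_iff)
    hence "c s $ i \<noteq> 0" using nrm[of s i] by auto
    hence "c s \<noteq> 0" by auto
    hence h: "homog_coords (c s) (abs_cproj (c s))" by (simp add: homog_coords_def)
    have "\<forall>i j. cmod (c s $ i) = cmod (c s $ j)"
      using iffD1[OF clifford_torus_iff[OF x(1)] p] unfolding nrm .
    hence "abs_cproj (c s) \<in> clifford_torus" using clifford_torus_iff[OF h] by simp
    thus ?thesis using h by blast
  qed
  have "((\<lambda>s. exp (\<i> * of_real (t i) * of_real s) * x $ i) has_vector_derivative v $ i) (at 0)" for i
  proof -
    have "((\<lambda>s. exp (s *\<^sub>R (\<i> * of_real (t i))) * x $ i) has_vector_derivative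
        exp (0 *\<^sub>R (\<i> * of_real (t i))) * (\<i> * of_real (t i)) * x $ i) (at 0)"
      by (rule bounded_linear.has_vector_derivative[OF bounded_linear_mult_left
            exp_scaleR_has_vector_derivative_right])
    thus ?thesis by (simp add: v_def scaleR_conv_of_real mult_ac)
  qed
  hence comp: "((\<lambda>s. c s $ i) has_derivative (\<lambda>s. s *\<^sub>R v $ i)) (at 0)" for i
    by (simp add: c_def has_vector_derivative_def)
  have "(c has_vector_derivative v) (at 0)"
    unfolding has_vector_derivative_def has_derivative_componentwise_within[of c]
  proof
    fix b :: "complex^'m" assume "b \<in> Basis"
    then obtain i u where b: "b = axis i u" by (auto simp: Basis_vec_def)
    show "((\<lambda>s. c s \<bullet> b) has_derivative (\<lambda>s. (s *\<^sub>R v) \<bullet> b)) (at 0)"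
      using has_derivative_inner_left[OF comp[of i], of u] by (simp add: b inner_axis)
  qed
  moreover have "c 0 = x" by (simp add: c_def vec_eq_iff)
  \<comment> \<open>The coordinates of \<open>x\<close> share one modulus, so this inner product is
    a multiple of the sum of the \<open>t i\<close>.\<close>
  moreover have "cinner v x = 0"
  proof -
    obtain i0 :: 'm where True by blast
    have "x $ i * cnj (x $ i) = of_real ((cmod (x $ i0))\<^sup>2)" for i
    proof -
      have "cmod (x $ i0) = cmod (x $ i)" using iffD1[OF clifford_torus_iff[OF x(1)] p] by blast
      thus ?thesis using complex_norm_square[of "x $ i"] by simp
    qed
    hence "cinner v x = (\<Sum>i\<in>UNIV. \<i> * of_real (t i) * of_real ((cmod (x $ i0))\<^sup>2))"
      by (simp only: cinner_def v_def vec_lambda_beta mult.assoc)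
    also have "\<dots> = \<i> * of_real (\<Sum>i\<in>UNIV. t i) * of_real ((cmod (x $ i0))\<^sup>2)"
      by (simp add: sum_distrib_left[symmetric] sum_distrib_right[symmetric])
    finally show ?thesis by (simp add: t)
  qed
  hence "M = proj_deriv x v" using x(2) by (simp add: proj_deriv_rank_one t(1) v_def)
  ultimately show "M \<in> tangent_space_cproj clifford_torus p"
    unfolding tangent_space_cproj_def mem_Collect_eq
    using x(1) c1 by (intro exI[of _ c] exI[of _ v] conjI allI) simp_all
qed

section \<open>Block matrices indexed by an option type\<close>

lemma sum_option: "(\<Sum>i\<in>UNIV. f i) = f None + (\<Sum>k\<in>UNIV. f (Some k))"
  for f :: "'n::finite option \<Rightarrow> 'a::comm_monoid_add"
  by (simp add: UNIV_option_conv sum.reindex)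

lemma prod_option: "(\<Prod>i\<in>UNIV. f i) = f None * (\<Prod>k\<in>UNIV. f (Some k))"
  for f :: "'n::finite option \<Rightarrow> 'a::comm_monoid_mult"
  by (simp add: UNIV_option_conv prod.reindex)

definition block_matrix :: "'a::comm_ring_1 \<Rightarrow> 'a^'n^'n::finite \<Rightarrow> 'a^'n option^'n option" where
  "block_matrix c A = (\<chi> i j. case i of
      None \<Rightarrow> (case j of None \<Rightarrow> c | Some l \<Rightarrow> 0)
    | Some k \<Rightarrow> (case j of None \<Rightarrow> 0 | Some l \<Rightarrow> A $ k $ l))"

text \<open>In the Leibniz expansion only permutations fixing \<open>None\<close> contribute. They
  extend the permutations of the smaller index type, with the same sign.\<close>

lemma det_block_matrix: "det (block_matrix c A) = c * det A"
proof -
  define F where "F p = of_int (sign p) * (\<Prod>i\<in>UNIV. block_matrix c A $ i $ p i)" for p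
  let ?e = "\<lambda>q. map_permutation UNIV Some q :: 'b option \<Rightarrow> 'b option"
  have bij: "bij_betw Some UNIV (range (Some :: 'b \<Rightarrow> _))" by (simp add: bij_betw_def)
  have "?e = (\<lambda>q x. if x \<in> range Some then Some (q (inv_into UNIV Some x)) else x)"
    by (auto simp: fun_eq_iff map_permutation_def restrict_id_def)
  hence bij': "bij_betw ?e {q. q permutes UNIV} {p. p permutes range Some}"
    using bij_betw_permutations[OF bij] by simp
  have None: "p None = None" if "p permutes range Some" for p :: "'b option \<Rightarrow> 'b option"
    using that by (rule permutes_not_in) auto
  have "F p = 0" if p: "p permutes UNIV" "\<not> p permutes range Some" for p
  proof -
    have "p None \<noteq> None"
    proof
      assume "p None = None"
      hence "\<forall>x\<in>UNIV - range Some. p x = x" by (metis DiffE not_None_eq rangeI)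
      thus False using permutes_superset[OF p(1)] p(2) by blast
    qed
    then obtain l where "p None = Some l" by blast
    hence "block_matrix c A $ None $ p None = 0" by (simp add: block_matrix_def)
    thus ?thesis unfolding F_def prod_option by simp
  qed
  moreover have "{p. p permutes range Some} \<subseteq> {p. p permutes (UNIV :: 'b option set)}"
    using permutes_subset by blast
  ultimately have "det (block_matrix c A) = (\<Sum>p\<in>{p. p permutes range Some}. F p)"
    unfolding det_def F_def[symmetric] by (intro sum.mono_neutral_right) auto
  also have "\<dots> = (\<Sum>q\<in>{q. q permutes UNIV}. F (?e q))"
    using sum.reindex_bij_betw[OF bij', of F] by simp
  also have "\<dots> = (\<Sum>q\<in>{q. q permutes UNIV}. c * (of_int (sign q) * (\<Prod>i\<in>UNIV. A $ i $ q i)))"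
  proof (rule sum.cong[OF refl])
    fix q :: "'b \<Rightarrow> 'b" assume "q \<in> {q. q permutes UNIV}"
    hence q: "q permutes UNIV" by simp
    have "?e q None = None" using map_permutation_permutes[OF bij q] None by blast
    moreover have "?e q (Some k) = Some (q k)" for k
      by (rule map_permutation_apply) auto
    moreover have "sign (?e q) = sign q"
      by (rule sign_map_permutation) (use q in auto)
    ultimately show "F (?e q) = c * (of_int (sign q) * (\<Prod>i\<in>UNIV. A $ i $ q i))"
      unfolding F_def prod_option by (simp add: block_matrix_def mult_ac)
  qed
  also have "\<dots> = c * det A" by (simp add: det_def sum_distrib_left)
  finally show ?thesis .
qed

text \<open>Places C^n in C^(n+1) as the complement of \<open>axis None 1\<close>, so that a unitary
  matrix with first column \<open>x\<close> carries it onto the complement of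
  \<open>x\<close>.\<close>

definition embed_option :: "complex^'n \<Rightarrow> complex^'n::finite option" where
  "embed_option u = (\<chi> i. case i of None \<Rightarrow> 0 | Some k \<Rightarrow> u $ k)"

lemma embed_option_nth [simp]: "embed_option u $ None = 0" "embed_option u $ Some k = u $ k"
  by (simp_all add: embed_option_def)

lemma vec_option_eqI: "u $ None = v $ None \<Longrightarrow> (\<And>k. u $ Some k = v $ Some k) \<Longrightarrow> u = v"
  unfolding vec_eq_iff by (metis not_None_eq)

lemma embed_option_add: "embed_option (u + v) = embed_option u + embed_option v"
  by (rule vec_option_eqI) auto

lemma embed_option_cmult: "embed_option (c *s u) = c *s embed_option u"
  by (rule vec_option_eqI) auto

lemma cinner_embed: "cinner (embed_option u) (embed_option v) = cinner u v"
  by (simp add: cinner_def sum_option)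

lemma embed_option_axis: "embed_option (axis k 1) = axis (Some k) 1"
  by (rule vec_option_eqI) (auto simp: axis_def)

lemma embed_option_exists: "x $ None = 0 \<Longrightarrow> \<exists>u. x = embed_option u"
  by (rule exI[of _ "\<chi> k. x $ Some k"], rule vec_option_eqI) auto

lemma block_matrix_embed: "block_matrix c A *v embed_option u = embed_option (A *v u)"
  by (rule vec_option_eqI) (auto simp: matrix_vector_mult_def sum_option block_matrix_def)

lemma block_matrix_axis: "block_matrix c A *v axis None 1 = c *s axis None 1"
  unfolding matrix_vector_axis
  by (rule vec_option_eqI) (auto simp: column_def axis_def block_matrix_def)

lemma block_matrix_unitary:
  fixes A :: "complex^'n^'n::finite"
  assumes "unitary_matrix A" "c * cnj c = 1"
  shows "unitary_matrix (block_matrix c A)"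
proof -
  have A: "cinner (column l A) (column k A) = (if k = l then 1 else 0)" for k l
    using assms(1) unitary_matrix_columns by blast
  have N: "column None (block_matrix c A) = c *s axis None 1"
    using block_matrix_axis[of c A] by (simp only: matrix_vector_axis)
  have S: "column (Some k) (block_matrix c A) = embed_option (column k A)" for k
    using block_matrix_embed[of c A "axis k 1"] by (simp only: matrix_vector_axis embed_option_axis)
  have orth: "cinner (embed_option u) (axis None 1) = 0" for u :: "complex^'n"
    by (simp add: cinner_axis_right)
  hence orth': "cinner (axis None 1) (embed_option u) = 0" for u :: "complex^'n"
    using cnj_cinner[of "embed_option u" "axis None 1"] by simp
  have one: "cinner (axis None 1) (axis None 1 :: complex^'n option) = 1"
    by (simp add: cinner_axis_right)
  have "cinner (column l (block_matrix c A)) (column k (block_matrix c A)) = (if k = l then 1 else 0)" for k l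
    using assms(2) by (cases k; cases l)
      (simp_all add: N S A orth orth' one cinner_embed cinner_cmult_left cinner_cmult_right mult.commute)
  thus ?thesis unfolding unitary_matrix_columns by blast
qed

section \<open>Unitary trivializations\<close>

lemma mat_scalar_mult: "mat c ** M = (\<chi> i j. c * M $ i $ j)"
  for M :: "complex^'m^'m::finite"
proof -
  have "(mat c ** M) $ i $ j = (\<Sum>k\<in>UNIV. if k = i then c * M $ k $ j else 0)" for i j
    unfolding matrix_matrix_mult_def mat_def vec_lambda_beta by (rule sum.cong) auto
  thus ?thesis by (simp add: vec_eq_iff)
qed

lemma mat_scalar_vector: "mat c *v y = c *s y"
  for y :: "complex^'m::finite"
proof -
  have "(mat c *v y) $ i = (\<Sum>k\<in>UNIV. if k = i then c * y $ k else 0)" for i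
    unfolding matrix_vector_mult_def mat_def vec_lambda_beta by (rule sum.cong) auto
  thus ?thesis by (simp add: vec_eq_iff)
qed

text \<open>\<open>U z\<close> maps the complement of the first basis vector isometrically onto the
  complement of \<open>x z\<close>, which represents the tangent space at
  \<open>w z\<close>.\<close>

lemma unitary_trivialization_of_frame:
  fixes w :: "complex \<Rightarrow> ('n::finite) option cproj"
  assumes x: "continuous_on (cball 0 1) x" "\<And>z. z \<in> cball 0 1 \<Longrightarrow> homog_coords (x z) (w z)"
      "\<And>z. z \<in> cball 0 1 \<Longrightarrow> cinner (x z) (x z) = 1"
    and U: "continuous_on (cball 0 1) U" "\<And>z. z \<in> cball 0 1 \<Longrightarrow> unitary_matrix (U z)"
      "\<And>z. z \<in> cball 0 1 \<Longrightarrow> U z *v axis None 1 = x z"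
  shows "unitary_trivialization w (\<lambda>z u. rank_one (U z *v embed_option u) (x z))"
  unfolding unitary_trivialization_def
proof (intro conjI ballI allI)
  have cU: "continuous_on (cball 0 1 \<times> UNIV) (\<lambda>p. U (fst p))"
    by (rule continuous_on_compose2[OF U(1)]) (auto intro!: continuous_intros)
  have cx: "continuous_on (cball 0 1 \<times> UNIV) (\<lambda>p. x (fst p))"
    by (rule continuous_on_compose2[OF x(1)]) (auto intro!: continuous_intros)
  show "continuous_on (cball 0 1 \<times> UNIV) (\<lambda>(z, u). rank_one (U z *v embed_option u) (x z))"
    unfolding case_prod_unfold rank_one_def matrix_vector_mult_def sum_option
    by (simp, intro continuous_intros cU cx)
next
  fix z :: complex assume z: "z \<in> cball 0 1"
  show "rank_one (U z *v embed_option (u + v)) (x z) = rank_one (U z *v embed_option u) (x z) + rank_one (U z *v embed_option v) (x z)" for u v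
    by (simp add: embed_option_add matrix_vector_right_distrib rank_one_def vec_eq_iff algebra_simps)
  show "rank_one (U z *v embed_option (c *s u)) (x z) = mat c ** rank_one (U z *v embed_option u) (x z)" for c u
  proof -
    have "U z *v (c *s embed_option u) = c *s (U z *v embed_option u)"
      by (simp add: vec_eq_iff matrix_vector_mult_def sum_distrib_left mult_ac)
    thus ?thesis by (simp add: mat_scalar_mult embed_option_cmult rank_one_def vec_eq_iff)
  qed
  show "cinner_matrix (rank_one (U z *v embed_option u) (x z)) (rank_one (U z *v embed_option v) (x z)) = cinner u v" for u v
    by (simp add: cinner_rank_one unitary_matrix_cinner[OF U(2)[OF z]] cinner_embed x(3)[OF z])
  have orth: "cinner (U z *v y) (x z) = y $ None" for y
    unfolding U(3)[OF z, symmetric] unitary_matrix_cinner[OF U(2)[OF z]] cinner_axis_right ..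
  show "range (\<lambda>u. rank_one (U z *v embed_option u) (x z)) = tangent_space_cproj UNIV (w z)"
    unfolding tangent_space_UNIV[OF x(2)[OF z] x(3)[OF z]]
  proof (intro equalityI subsetI)
    fix M assume "M \<in> {rank_one y (x z) | y. cinner y (x z) = 0}"
    then obtain y where y: "M = rank_one y (x z)" "cinner y (x z) = 0" by blast
    define y' where "y' = adjoint_matrix (U z) *v y"
    have y': "y = U z *v y'" by (simp add: y'_def unitary_matrix_cancel[OF U(2)[OF z]])
    hence "y' $ None = 0" using y(2) orth by simp
    then obtain u where "y' = embed_option u" using embed_option_exists by blast
    thus "M \<in> range (\<lambda>u. rank_one (U z *v embed_option u) (x z))" using y(1) y' by blast
  qed (auto simp: orth)
qed

text \<open>A tangent vector is recovered from its value at the unit vector \<open>x z\<close>. The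
  values of the \<open>\<Phi> z (axis k 1)\<close> there are orthonormal and orthogonal to
  \<open>x z\<close>, hence complete it to a unitary matrix.\<close>

lemma frame_of_unitary_trivialization:
  fixes w :: "complex \<Rightarrow> ('n::finite) option cproj"
  assumes \<Phi>: "unitary_trivialization w \<Phi>"
    and x: "continuous_on (cball 0 1) x" "\<And>z. z \<in> cball 0 1 \<Longrightarrow> homog_coords (x z) (w z)"
      "\<And>z. z \<in> cball 0 1 \<Longrightarrow> cinner (x z) (x z) = 1"
  obtains U where "continuous_on (cball 0 1) U" "\<And>z. z \<in> cball 0 1 \<Longrightarrow> unitary_matrix (U z)"
    "\<And>z. z \<in> cball 0 1 \<Longrightarrow> U z *v axis None 1 = x z"
    "\<And>z u. z \<in> cball 0 1 \<Longrightarrow> \<Phi> z u = rank_one (U z *v embed_option u) (x z)"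
proof -
  define U where "U z = (\<chi> i j. case j of None \<Rightarrow> x z $ i | Some k \<Rightarrow> (\<Phi> z (axis k 1) *v x z) $ i)" for z
  have cont\<Phi>: "continuous_on (cball 0 1 \<times> UNIV) (\<lambda>(z, u). \<Phi> z u)"
    and add: "\<And>z u v. z \<in> cball 0 1 \<Longrightarrow> \<Phi> z (u + v) = \<Phi> z u + \<Phi> z v"
    and mult: "\<And>z c u. z \<in> cball 0 1 \<Longrightarrow> \<Phi> z (c *s u) = mat c ** \<Phi> z u"
    and iso: "\<And>z u v. z \<in> cball 0 1 \<Longrightarrow> cinner_matrix (\<Phi> z u) (\<Phi> z v) = cinner u v"
    and ran: "\<And>z. z \<in> cball 0 1 \<Longrightarrow> range (\<Phi> z) = tangent_space_cproj UNIV (w z)"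
    using \<Phi> unfolding unitary_trivialization_def by auto
  have col0: "column None (U z) = x z" for z by (simp add: U_def column_def vec_eq_iff)
  have colS: "column (Some k) (U z) = \<Phi> z (axis k 1) *v x z" for z k
    by (simp add: U_def column_def vec_eq_iff)
  have rep: "\<Phi> z u = rank_one (\<Phi> z u *v x z) (x z)" "cinner (\<Phi> z u *v x z) (x z) = 0"
    if z: "z \<in> cball 0 1" for z u
  proof -
    have "\<Phi> z u \<in> {rank_one y (x z) | y. cinner y (x z) = 0}"
      using ran[OF z] tangent_space_UNIV[OF x(2)[OF z] x(3)[OF z]] by blast
    then obtain y where "\<Phi> z u = rank_one y (x z)" "cinner y (x z) = 0" by blast
    thus "\<Phi> z u = rank_one (\<Phi> z u *v x z) (x z)" "cinner (\<Phi> z u *v x z) (x z) = 0"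
      using x(3)[OF z] by (simp_all add: rank_one_apply)
  qed
  have inner: "cinner (\<Phi> z u *v x z) (\<Phi> z v *v x z) = cinner u v" if z: "z \<in> cball 0 1" for z u v
  proof -
    have "cinner_matrix (rank_one (\<Phi> z u *v x z) (x z)) (rank_one (\<Phi> z v *v x z) (x z)) = cinner u v"
      using iso[OF z, of u v] rep(1)[OF z, symmetric] by simp
    thus ?thesis by (simp add: cinner_rank_one x(3)[OF z])
  qed
  have "continuous_on (cball 0 1) U"
  proof -
    have "continuous_on (cball 0 1) (\<lambda>z. \<Phi> z u)" for u
    proof -
      have "continuous_on (cball 0 1) (\<lambda>z. case (z, u) of (z, u) \<Rightarrow> \<Phi> z u)"
        by (rule continuous_on_compose2[OF cont\<Phi>]) (auto intro!: continuous_intros)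
      thus ?thesis by simp
    qed
    hence "continuous_on (cball 0 1) (\<lambda>z. case j of None \<Rightarrow> x z $ i | Some k \<Rightarrow> (\<Phi> z (axis k 1) *v x z) $ i)" for i j
      unfolding matrix_vector_mult_def using x(1)
      by (cases j) (auto intro!: continuous_intros)
    thus ?thesis unfolding U_def by (intro continuous_on_vec_lambda)
  qed
  moreover have "unitary_matrix (U z)" if z: "z \<in> cball 0 1" for z
    unfolding unitary_matrix_columns
  proof (intro allI)
    fix k l
    have "cinner (x z) (\<Phi> z u *v x z) = 0" for u
      using rep(2)[OF z, of u] cnj_cinner[of "\<Phi> z u *v x z" "x z"] by simp
    thus "cinner (column l (U z)) (column k (U z)) = (if k = l then 1 else 0)"
      by (cases k; cases l)
        (simp_all add: col0 colS x(3)[OF z] rep(2)[OF z] inner[OF z] cinner_axis_right, simp add: axis_def)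
  qed
  moreover have "U z *v axis None 1 = x z" for z by (simp add: matrix_vector_axis col0)
  moreover have "\<Phi> z u = rank_one (U z *v embed_option u) (x z)" if z: "z \<in> cball 0 1" for z u
  proof -
    interpret additive "\<lambda>u. \<Phi> z u *v x z"
      by standard (simp add: add[OF z] matrix_vector_mult_add_rdistrib)
    have "\<Phi> z (c *s u) *v x z = c *s (\<Phi> z u *v x z)" for c u
      by (simp add: mult[OF z] matrix_vector_mul_assoc[symmetric] mat_scalar_vector)
    note sc = this
    have "\<Phi> z u *v x z = \<Phi> z (\<Sum>k\<in>UNIV. u $ k *s axis k 1) *v x z" by (simp only: basis_expansion)
    also have "\<dots> = (\<Sum>k\<in>UNIV. u $ k *s column (Some k) (U z))"
      by (simp only: sum sc colS)
    also have "\<dots> = U z *v embed_option u"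
      by (simp add: vec_eq_iff matrix_vector_mult_def sum_option column_def mult.commute)
    finally show ?thesis using rep(1)[OF z, of u] by simp
  qed
  ultimately show ?thesis by (rule that)
qed

section \<open>Lagrangian frames\<close>

text \<open>For \<open>g\<close> with coordinates of modulus 1, the tangent space of the torus at \<open>[g]\<close> is the image under
  this matrix of the real vectors orthogonal to the diagonal.\<close>

definition torus_matrix :: "complex^'m \<Rightarrow> complex^'m^'m::finite" where
  "torus_matrix g = (\<chi> i j. if i = j then \<i> * g $ i else 0)"

lemma torus_matrix_vector: "torus_matrix g *v t = (\<chi> i. \<i> * g $ i * t $ i)"
proof -
  have "(torus_matrix g *v t) $ i = (\<Sum>j\<in>UNIV. if j = i then \<i> * g $ i * t $ j else 0)" for i
    unfolding torus_matrix_def matrix_vector_mult_def vec_lambda_beta by (rule sum.cong) auto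
  thus ?thesis by (simp add: vec_eq_iff)
qed

lemma torus_matrix_unitary:
  assumes "\<And>i. cmod (g $ i) = 1"
  shows "unitary_matrix (torus_matrix g)"
proof (rule unitary_matrixI)
  fix u v
  have "g $ i * cnj (g $ i) = 1" for i using complex_norm_square[of "g $ i"] assms[of i] by simp
  hence "(\<i> * g $ i * u $ i) * cnj (\<i> * g $ i * v $ i) = u $ i * cnj (v $ i)" for i
    by (metis (no_types, lifting) complex_cnj_i complex_cnj_mult i_squared minus_mult_minus minus_mult_right
        mult.assoc mult.left_commute mult_1 mult_minus1 power2_eq_square)
  thus "cinner (torus_matrix g *v u) (torus_matrix g *v v) = cinner u v"
    by (simp add: cinner_def torus_matrix_vector)
qed

lemma det_torus_matrix: "det (torus_matrix g) = (\<Prod>i\<in>UNIV. \<i> * g $ i)"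
  unfolding torus_matrix_def by (subst det_diagonal) auto

text \<open>The unit vector along \<open>(1, ..., 1)\<close>; orthogonality to it means that the
  coordinates sum to 0.\<close>

definition diagonal_unit :: "complex^'m::finite" where
  "diagonal_unit = (\<chi> i. complex_of_real (inverse (sqrt (real CARD('m)))))"

lemma cinner_diagonal_unit: "cinner diagonal_unit (diagonal_unit :: complex^'m::finite) = 1"
proof -
  have "inverse (sqrt (real CARD('m))) * inverse (sqrt (real CARD('m))) = inverse (real CARD('m))"
    by (simp add: inverse_mult_distrib[symmetric])
  hence "complex_of_real (inverse (sqrt (real CARD('m)))) * complex_of_real (inverse (sqrt (real CARD('m)))) =
      of_real (inverse (real CARD('m)))"
    by (metis of_real_mult)
  thus ?thesis by (simp add: cinner_def diagonal_unit_def)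
qed

lemma cinner_diagonal_unit_right:
  "cinner t (diagonal_unit :: complex^'m::finite) = of_real (inverse (sqrt (real CARD('m)))) * (\<Sum>i\<in>UNIV. t $ i)"
  unfolding cinner_def diagonal_unit_def vec_lambda_beta sum_distrib_left complex_cnj_complex_of_real
  by (simp only: mult.commute)

locale torus_point =
  fixes g x :: "complex^'m::finite" and p :: "'m cproj"
  assumes g: "\<And>i. cmod (g $ i) = 1"
    and x: "x = complex_of_real (inverse (sqrt (real CARD('m)))) *s g"
    and p: "homog_coords g p"
begin

abbreviation G :: "complex^'m^'m" where "G \<equiv> torus_matrix g"

lemma G_unitary: "unitary_matrix G"
  using torus_matrix_unitary g by blast

text \<open>Hence the unitary \<open>G\<close> maps the complement of the diagonal onto the
  complement of \<open>x\<close>. The factor \<open>\<i>\<close> is the reason for the corner entry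
  of \<open>block_matrix \<i> A\<close>.\<close>

lemma G_diagonal_unit: "G *v diagonal_unit = \<i> *s x"
  by (simp add: torus_matrix_vector diagonal_unit_def x vec_eq_iff)

lemma cinner_x: "cinner x x = 1"
proof -
  have "cinner (\<i> *s x) (\<i> *s x) = 1"
    unfolding G_diagonal_unit[symmetric] unitary_matrix_cinner[OF G_unitary] by (rule cinner_diagonal_unit)
  thus ?thesis by (simp add: cinner_cmult_left cinner_cmult_right)
qed

lemma homog_x: "homog_coords x p"
  unfolding x by (rule homog_coords_cmult[OF p]) simp

text \<open>The angular velocities in \<open>tangent_space_torus\<close> refer to \<open>x\<close>,
  whereas \<open>G\<close> is built from \<open>g\<close>; this explains the rescaling by
  \<open>N\<close>.\<close>

lemma tangent_torus:
  "rank_one y x \<in> tangent_space_cproj clifford_torus p \<longleftrightarrow>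
    (\<exists>t. (\<forall>i. t $ i \<in> \<real>) \<and> cinner t diagonal_unit = 0 \<and> y = G *v t)"
proof -
  define N where "N = sqrt (real CARD('m))"
  have N: "N > 0" by (simp add: N_def)
  have pT: "p \<in> clifford_torus" using clifford_torus_iff[OF p] g by simp
  have Gt: "G *v (\<chi> i. complex_of_real (t i / N)) = (\<chi> i. \<i> * of_real (t i) * x $ i)" for t
    by (simp add: torus_matrix_vector x vec_eq_iff N_def[symmetric] field_simps)
  have ct: "cinner (\<chi> i. complex_of_real (t i / N)) diagonal_unit = 0 \<longleftrightarrow> (\<Sum>i\<in>UNIV. t i) = 0"
    for t :: "'m \<Rightarrow> real"
  proof -
    have "(\<Sum>i\<in>UNIV. complex_of_real (t i / N)) = of_real ((\<Sum>i\<in>UNIV. t i) / N)"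
      by (simp add: sum_divide_distrib)
    hence "cinner (\<chi> i. complex_of_real (t i / N)) diagonal_unit =
        of_real (inverse (sqrt (real CARD('m))) * ((\<Sum>i\<in>UNIV. t i) / N))"
      by (simp only: cinner_diagonal_unit_right vec_lambda_beta of_real_mult)
    thus ?thesis using N by (simp only: of_real_eq_0_iff) simp
  qed
  show ?thesis
    unfolding tangent_space_torus[OF homog_x cinner_x pT]
  proof
    assume "rank_one y x \<in> {rank_one (\<chi> i. \<i> * of_real (t i) * x $ i) x | t. (\<Sum>i\<in>UNIV. t i) = 0}"
    then obtain t where t: "rank_one y x = rank_one (\<chi> i. \<i> * of_real (t i) * x $ i) x" "(\<Sum>i\<in>UNIV. t i) = 0"
      by blast
    have "y = G *v (\<chi> i. complex_of_real (t i / N))"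
      using rank_one_inj[OF cinner_x t(1)] unfolding Gt .
    thus "\<exists>t. (\<forall>i. t $ i \<in> \<real>) \<and> cinner t diagonal_unit = 0 \<and> y = G *v t"
      using t(2) ct[of t] by (intro exI[of _ "\<chi> i. complex_of_real (t i / N)"]) simp
  next
    assume "\<exists>t. (\<forall>i. t $ i \<in> \<real>) \<and> cinner t diagonal_unit = 0 \<and> y = G *v t"
    then obtain t where t: "\<And>i. t $ i \<in> \<real>" "cinner t diagonal_unit = 0" "y = G *v t" by blast
    define s where "s i = N * Re (t $ i)" for i
    have ts: "t = (\<chi> i. complex_of_real (s i / N))"
      using N t(1) by (simp add: s_def vec_eq_iff complex_is_Real_iff complex_eq_iff)
    have "(\<Sum>i\<in>UNIV. s i) = 0" using t(2) ct[of s] unfolding ts by simp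
    moreover have "y = (\<chi> i. \<i> * of_real (s i) * x $ i)" unfolding t(3) ts Gt ..
    ultimately show "rank_one y x \<in> {rank_one (\<chi> i. \<i> * of_real (t i) * x $ i) x | t. (\<Sum>i\<in>UNIV. t i) = 0}"
      by blast
  qed
qed

end

lemma real_matrix_vector:
  fixes A :: "complex^'n^'m"
  assumes "\<And>i j. A $ i $ j \<in> \<real>" "\<And>j. t $ j \<in> \<real>"
  shows "(A *v t) $ i \<in> \<real>"
  using assms by (auto simp: matrix_vector_mult_def intro!: sum_in_Reals Reals_mult)

text \<open>An eigenvector of a unitary matrix is also one of its adjoint, so \<open>B\<close>
  preserves the complement of \<open>e\<close>.\<close>

lemma adjoint_axis_eigen:
  assumes "unitary_matrix B" "B *v e = \<i> *s e"
  shows "cinner (B *v y) e = \<i> * cinner y e"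
proof -
  have "cinner (B *v y) (B *v e) = cinner y e" by (rule unitary_matrix_cinner[OF assms(1)])
  hence "- \<i> * cinner (B *v y) e = cinner y e" by (simp add: assms(2) cinner_cmult_right)
  hence "\<i> * (- \<i> * cinner (B *v y) e) = \<i> * cinner y e" by simp
  thus ?thesis by (simp add: mult.assoc[symmetric])
qed

text \<open>The frame is the restriction of \<open>U\<^sup>* G R\<close> to the complement of the first basis
  vector, where the real rotation \<open>R\<close> maps that vector to the diagonal.\<close>

lemma lagrangian_frame_exists:
  fixes g x :: "complex^'n::finite option"
  assumes "torus_point g x p" and U: "unitary_matrix U" "U *v axis None 1 = x"
  obtains A where "unitary_matrix A" "{A *v s | s. \<forall>k. s $ k \<in> \<real>} =
     {u. rank_one (U *v embed_option u) x \<in> tangent_space_cproj clifford_torus p}"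
proof -
  interpret torus_point g x p by fact
  define e where "e = (axis None 1 :: complex^'n option)"
  define R where "R = unit_rotation e (diagonal_unit :: complex^'n option)"
  have ee: "cinner e e = 1" by (simp add: e_def cinner_axis_right)
  have ed: "cinner e (diagonal_unit :: complex^'n option) = of_real (inverse (sqrt (real CARD('n option))))"
  proof -
    have "cinner diagonal_unit e = complex_of_real (inverse (sqrt (real CARD('n option))))"
      by (simp only: e_def cinner_axis_right) (simp add: diagonal_unit_def)
    thus ?thesis using cnj_cinner[of diagonal_unit e] by (simp only: complex_cnj_complex_of_real)
  qed
  \<comment> \<open>The inner product of the two unit vectors is positive, so the rotation is
    defined; as both vectors are real, so is \<open>R\<close>.\<close>
  have "inverse (sqrt (real CARD('n option))) \<noteq> -1"
    using inverse_nonnegative_iff_nonnegative[of "sqrt (real CARD('n option))"] real_sqrt_ge_zero[of "real CARD('n option)"]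
    by linarith
  hence "cinner e (diagonal_unit :: complex^'n option) \<noteq> -1"
    unfolding ed by (metis of_real_1 of_real_eq_iff of_real_minus)
  hence R: "unitary_matrix R" "R *v e = diagonal_unit"
    unfolding R_def using unit_rotation_unitary[OF ee cinner_diagonal_unit] by blast+
  have er: "e $ i \<in> \<real>" "(diagonal_unit :: complex^'n option) $ i \<in> \<real>" for i
    by (auto simp: e_def axis_def diagonal_unit_def)
  have Rr: "R $ i $ j \<in> \<real>" for i j
    unfolding R_def unit_rotation_def vec_lambda_beta ed
    using er Reals_cnj_iff by (auto intro!: Reals_diff Reals_divide Reals_mult Reals_add)
  have Ra: "adjoint_matrix R $ i $ j \<in> \<real>" for i j using Rr by (simp add: Reals_cnj_iff)
  define B where "B = adjoint_matrix U ** G ** R"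
  have B: "unitary_matrix B"
    unfolding B_def by (intro unitary_matrix_mult unitary_matrix_adjoint U(1) G_unitary R(1))
  have Bv: "U *v (B *v y) = G *v (R *v y)" for y
    unfolding B_def matrix_vector_mul_assoc[symmetric] unitary_matrix_cancel[OF U(1)] ..
  \<comment> \<open>\<open>R\<close> sends \<open>e\<close> to the diagonal, \<open>G\<close> sends
    that to \<open>\<i> *s x\<close>, and the adjoint of \<open>U\<close> returns it to
    \<open>\<i> *s e\<close>. Therefore \<open>B\<close> splits off the block
    \<open>A\<close>.\<close>
  have "U *v (B *v e) = U *v (\<i> *s e)"
    unfolding Bv R(2) G_diagonal_unit by (simp add: e_def vector_scalar_commute U(2))
  hence Be: "B *v e = \<i> *s e" by (metis unitary_matrix_cancel(1)[OF U(1)])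
  define A where "A = (\<chi> k l. B $ Some k $ Some l)"
  have BA: "B *v embed_option s = embed_option (A *v s)" for s
  proof (rule vec_option_eqI)
    have "cinner (B *v embed_option s) e = \<i> * cinner (embed_option s) e" by (rule adjoint_axis_eigen[OF B Be])
    thus "(B *v embed_option s) $ None = embed_option (A *v s) $ None" by (simp add: e_def cinner_axis_right)
    show "(B *v embed_option s) $ Some k = embed_option (A *v s) $ Some k" for k
      by (simp add: matrix_vector_mult_def sum_option A_def)
  qed
  have "unitary_matrix A"
  proof (rule unitary_matrixI)
    fix s t
    have "cinner (A *v s) (A *v t) = cinner (B *v embed_option s) (B *v embed_option t)"
      unfolding BA cinner_embed ..
    thus "cinner (A *v s) (A *v t) = cinner s t"
      unfolding unitary_matrix_cinner[OF B] cinner_embed .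
  qed
  moreover have "{A *v s | s. \<forall>k. s $ k \<in> \<real>} =
     {u. rank_one (U *v embed_option u) x \<in> tangent_space_cproj clifford_torus p}"
  proof (intro equalityI subsetI)
    fix u assume "u \<in> {A *v s | s. \<forall>k. s $ k \<in> \<real>}"
    then obtain s where s: "u = A *v s" "\<And>k. s $ k \<in> \<real>" by blast
    have "embed_option s $ i \<in> \<real>" for i using s(2) by (cases i) auto
    hence "\<forall>i. (R *v embed_option s) $ i \<in> \<real>" using real_matrix_vector Rr by blast
    moreover have "cinner (R *v embed_option s) diagonal_unit = 0"
      unfolding R(2)[symmetric] unitary_matrix_cinner[OF R(1)] by (simp add: e_def cinner_axis_right)
    moreover have "U *v embed_option u = G *v (R *v embed_option s)" unfolding s(1) BA[symmetric] Bv ..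
    ultimately show "u \<in> {u. rank_one (U *v embed_option u) x \<in> tangent_space_cproj clifford_torus p}"
      unfolding mem_Collect_eq tangent_torus by blast
  next
    fix u assume "u \<in> {u. rank_one (U *v embed_option u) x \<in> tangent_space_cproj clifford_torus p}"
    then obtain t where t: "\<And>i. t $ i \<in> \<real>" "cinner t diagonal_unit = 0" "U *v embed_option u = G *v t"
      unfolding mem_Collect_eq tangent_torus by blast
    define y where "y = adjoint_matrix R *v t"
    have ty: "t = R *v y" by (simp add: y_def unitary_matrix_cancel[OF R(1)])
    have "cinner y e = 0"
      using t(2) unfolding ty R(2)[symmetric] unitary_matrix_cinner[OF R(1)] .
    hence "y $ None = 0" by (simp add: e_def cinner_axis_right)
    then obtain s where s: "y = embed_option s" using embed_option_exists by blast
    have "y $ i \<in> \<real>" for i unfolding y_def using real_matrix_vector Ra t(1) by blast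
    hence sr: "\<forall>k. s $ k \<in> \<real>" using s embed_option_nth(2) by metis
    have "U *v embed_option u = U *v embed_option (A *v s)" unfolding t(3) ty s BA[symmetric] Bv ..
    hence "embed_option u = embed_option (A *v s)" by (metis unitary_matrix_cancel(1)[OF U(1)])
    hence "u = A *v s" by (metis embed_option_nth(2) vec_eq_iff)
    thus "u \<in> {A *v s | s. \<forall>k. s $ k \<in> \<real>}" using sr by blast
  qed
  ultimately show ?thesis by (rule that)
qed

text \<open>The matrix \<open>G\<^sup>* U (block_matrix \<i> A)\<close> is real and unitary, so its determinant is
  \<open>1\<close> or \<open>-1\<close>.\<close>

lemma lagrangian_frame_det:
  fixes g x :: "complex^'n::finite option"
  assumes "torus_point g x p" and U: "unitary_matrix U" "U *v axis None 1 = x"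
    and A: "unitary_matrix A" "{A *v s | s. \<forall>k. s $ k \<in> \<real>} =
     {u. rank_one (U *v embed_option u) x \<in> tangent_space_cproj clifford_torus p}"
  shows "det (A ** transpose A) * (det U)\<^sup>2 = - (det (torus_matrix g))\<^sup>2"
proof -
  interpret torus_point g x p by fact
  define Q where "Q = adjoint_matrix G ** (U ** block_matrix \<i> A)"
  have Q: "unitary_matrix Q"
    unfolding Q_def using block_matrix_unitary[OF A(1), of "\<i>"]
    by (intro unitary_matrix_mult unitary_matrix_adjoint U(1) G_unitary) simp
  have Qv: "Q *v y = adjoint_matrix G *v (U *v (block_matrix \<i> A *v y))" for y
    unfolding Q_def matrix_vector_mul_assoc[symmetric] ..
  \<comment> \<open>The first column is the preimage of \<open>\<i> *s x\<close> under
    \<open>G\<close>, the diagonal unit vector; the others are the real coordinates of vectors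
    tangent to the torus.\<close>
  have "(Q *v axis j 1) $ i \<in> \<real>" for i j
  proof (cases j)
    case None
    have "U *v (\<i> *s axis None 1) = \<i> *s x" by (simp add: vector_scalar_commute U(2))
    hence "Q *v axis j 1 = diagonal_unit"
      unfolding None Qv block_matrix_axis
      using G_diagonal_unit unitary_matrix_cancel(1)[OF G_unitary] by metis
    thus ?thesis by (simp add: diagonal_unit_def)
  next
    case (Some k)
    have "A *v axis k 1 \<in> {A *v s | s. \<forall>k. s $ k \<in> \<real>}"
      by (auto simp: axis_def intro!: exI[of _ "axis k 1"])
    then obtain t where t: "\<And>i. t $ i \<in> \<real>" "U *v embed_option (A *v axis k 1) = G *v t"
      unfolding A(2) mem_Collect_eq tangent_torus by blast
    have "Q *v axis j 1 = t"
      unfolding Some Qv embed_option_axis[symmetric] block_matrix_embed t(2)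
      by (rule unitary_matrix_cancel(1)[OF G_unitary])
    thus ?thesis using t(1) by simp
  qed
  hence "Q $ i $ j \<in> \<real>" for i j by (simp add: matrix_vector_axis column_def)
  hence Q1: "(det Q)\<^sup>2 = 1" using real_unitary_det[OF Q] by blast
  have "G ** Q = U ** block_matrix \<i> A"
    unfolding Q_def matrix_mul_assoc using G_unitary unitary_matrix_iff_right[of G] by simp
  hence "det G * det Q = det U * (\<i> * det A)" by (metis det_mul det_block_matrix)
  \<comment> \<open>Squaring removes the sign of \<open>det Q\<close> and turns the corner entry
    \<open>\<i>\<close> into the minus sign.\<close>
  hence "(det G * det Q)\<^sup>2 = (det U * (\<i> * det A))\<^sup>2" by simp
  hence "(det G)\<^sup>2 = - ((det U)\<^sup>2 * (det A)\<^sup>2)" by (simp add: power_mult_distrib Q1)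
  thus ?thesis by (simp add: det_mul power2_eq_square mult_ac)
qed

section \<open>Normalized lifts and the degree of the Maslov loop\<close>

lemma torus_point_normalized:
  fixes g :: "complex^'m::finite"
  assumes "\<And>i. cmod (g $ i) = 1" "homog_coords g p"
  shows "torus_point g (complex_of_real (inverse (norm g)) *s g) p"
proof
  have "norm g = sqrt (real CARD('m))"
    using assms(1) by (simp add: norm_vec_def L2_set_def)
  thus "complex_of_real (inverse (norm g)) *s g = complex_of_real (inverse (sqrt (real CARD('m)))) *s g"
    by simp
qed (use assms in auto)

lemma cinner_normalized:
  assumes "g \<noteq> 0"
  shows "cinner (complex_of_real (inverse (norm g)) *s g) (complex_of_real (inverse (norm g)) *s g) = 1"
  unfolding cinner_cmult_left cinner_cmult_right cinner_self[of g]
  using assms by (simp add: power2_eq_square field_simps)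

text \<open>\<open>det U\<close> and the cofactors of the powers of \<open>\<zeta>\<close> extend to
  the disc without zeros and do not wind. Each coordinate contributes
  \<open>\<zeta> ^ \<mu> i\<close>, counted twice because of the square.\<close>

lemma maslov_degree:
  fixes g :: "complex \<Rightarrow> complex^'n::finite option"
  assumes g: "\<And>z i. z \<in> cball 0 1 \<Longrightarrow> g z $ i = blaschke_product (\<theta> i) (\<mu> i) (\<alpha> i) z"
    and \<alpha>: "\<And>i j. j \<in> {1..\<mu> i} \<Longrightarrow> \<alpha> i j \<in> ball 0 1"
    and U: "continuous_on (cball 0 1) U" "\<And>z. z \<in> cball 0 1 \<Longrightarrow> unitary_matrix (U z)"
    and f: "\<And>\<zeta>. \<zeta> \<in> sphere 0 1 \<Longrightarrow> f \<zeta> * (det (U \<zeta>))\<^sup>2 = - (det (torus_matrix (g \<zeta>)))\<^sup>2"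
  shows "circle_degree f = of_int (2 * (\<Sum>i\<in>UNIV. int (\<mu> i)))"
proof -
  have "\<exists>K. continuous_on (cball 0 1) K \<and> (\<forall>z\<in>cball 0 1. K z \<noteq> 0) \<and>
    (\<forall>\<zeta>\<in>sphere 0 1. blaschke_product (\<theta> i) (\<mu> i) (\<alpha> i) \<zeta> = \<zeta> ^ \<mu> i * K \<zeta>)" for i
    by (rule blaschke_product_monomial[of "\<mu> i" "\<alpha> i" "\<theta> i"]) (use \<alpha> in auto)
  then obtain K where K: "\<And>i. continuous_on (cball 0 1) (K i)"
    "\<And>i z. z \<in> cball 0 1 \<Longrightarrow> K i z \<noteq> 0"
    "\<And>i \<zeta>. \<zeta> \<in> sphere 0 1 \<Longrightarrow> blaschke_product (\<theta> i) (\<mu> i) (\<alpha> i) \<zeta> = \<zeta> ^ \<mu> i * K i \<zeta>"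
    by metis
  have nz: "det (U z) \<noteq> 0" if "z \<in> cball 0 1" for z
    using unitary_matrix_det_nonzero[OF U(2)[OF that]] .
  define H where "H z = - (\<Prod>i\<in>UNIV. \<i> * K i z)\<^sup>2 / (det (U z))\<^sup>2" for z
  have "continuous_on (cball 0 1) (\<lambda>z. det (U z))"
    unfolding det_def by (intro continuous_intros U(1))
  hence H1: "continuous_on (cball 0 1) H"
    unfolding H_def using nz by (intro continuous_intros K(1)) auto
  have H2: "H z \<noteq> 0" if "z \<in> cball 0 1" for z
    using nz[OF that] K(2)[OF that] by (simp add: H_def)
  have "f \<zeta> = \<zeta> ^ (2 * (\<Sum>i\<in>UNIV. \<mu> i)) * H \<zeta>" if \<zeta>: "\<zeta> \<in> sphere 0 1" for \<zeta>
  proof -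
    have \<zeta>': "\<zeta> \<in> cball 0 1" using \<zeta> by simp
    have "det (torus_matrix (g \<zeta>)) = (\<Prod>i\<in>UNIV. \<zeta> ^ \<mu> i * (\<i> * K i \<zeta>))"
      unfolding det_torus_matrix g[OF \<zeta>'] K(3)[OF \<zeta>] by (simp only: mult_ac)
    also have "\<dots> = \<zeta> ^ (\<Sum>i\<in>UNIV. \<mu> i) * (\<Prod>i\<in>UNIV. \<i> * K i \<zeta>)"
      by (simp only: prod.distrib power_sum)
    finally have "f \<zeta> * (det (U \<zeta>))\<^sup>2 = \<zeta> ^ (2 * (\<Sum>i\<in>UNIV. \<mu> i)) * - (\<Prod>i\<in>UNIV. \<i> * K i \<zeta>)\<^sup>2"
      unfolding f[OF \<zeta>] by (simp only: power_mult_distrib power_mult[symmetric] mult.commute mult_minus_right)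
    thus ?thesis using nz[OF \<zeta>'] by (simp add: H_def field_simps)
  qed
  from circle_degree_monomial[OF H1 H2 this] show ?thesis by simp
qed

section \<open>Assembly of the factorization and the Maslov index\<close>

theorem theorem10p1:
  fixes w :: "complex \<Rightarrow> ('n::finite) option cproj"
  assumes "holomorphic_disc w"
  shows "\<exists>(\<mu> :: 'n option \<Rightarrow> nat) (\<theta> :: 'n option \<Rightarrow> real) (\<alpha> :: 'n option \<Rightarrow> nat \<Rightarrow> complex).
           (\<forall>i. \<forall>j\<in>{1..\<mu> i}. \<alpha> i j \<in> ball 0 1) \<and>
           (\<forall>z\<in>cball 0 1. homog_coords (\<chi> i. blaschke_product (\<theta> i) (\<mu> i) (\<alpha> i) z) (w z)) \<and>
           (\<Inter>i. \<Union>j\<in>{1..\<mu> i}. {\<alpha> i j}) = {} \<and>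
           maslov_index w = 2 * (\<Sum>i\<in>UNIV. int (\<mu> i))"
proof -
  interpret holo_disc w None by standard (rule assms)
  obtain g where g: "\<And>i. unimodular_disc (\<lambda>z. g z $ i)"
    and homog: "\<And>z. z \<in> cball 0 1 \<Longrightarrow> homog_coords (g z) (w z)"
    by (rule lift) blast
  define P where "P i t m a \<longleftrightarrow> (\<forall>j\<in>{1..m}. a j \<in> ball 0 1) \<and>
      (\<forall>z\<in>cball 0 1. g z $ i = blaschke_product t m a z)" for i t m a
  have "\<exists>t m a. P i t m a" for i
    using unimodular_disc_imp_blaschke[OF g[of i]] unfolding finite_blaschke_def P_def .
  hence "\<forall>i. \<exists>t m a. P i t m a" by blast
  then obtain \<theta> \<mu> \<alpha> where P: "\<And>i. P i (\<theta> i) (\<mu> i) (\<alpha> i)" by metis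
  have \<alpha>: "\<alpha> i j \<in> ball 0 1" if "j \<in> {1..\<mu> i}" for i j
    using P[of i] that unfolding P_def by blast
  have gB: "g z $ i = blaschke_product (\<theta> i) (\<mu> i) (\<alpha> i) z" if "z \<in> cball 0 1" for z i
    using P[of i] that unfolding P_def by blast
  have g0: "g z \<noteq> 0" if "z \<in> cball 0 1" for z
    using homog[OF that] by (simp add: homog_coords_def)

  \<comment> \<open>A point of the intersection would be a common zero of the homogeneous
    coordinates.\<close>
  have "(\<Inter>i. \<Union>j\<in>{1..\<mu> i}. {\<alpha> i j}) = {}"
  proof (rule ccontr)
    assume "(\<Inter>i. \<Union>j\<in>{1..\<mu> i}. {\<alpha> i j}) \<noteq> {}"
    then obtain a where "a \<in> (\<Inter>i. \<Union>j\<in>{1..\<mu> i}. {\<alpha> i j})" by (meson ex_in_conv)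
    hence a: "\<exists>j\<in>{1..\<mu> i}. a = \<alpha> i j" for i by simp
    obtain j0 where "j0 \<in> {1..\<mu> None}" "a = \<alpha> None j0" using a[of None] by blast
    hence "a \<in> ball 0 1" using \<alpha> by simp
    hence a1: "a \<in> cball 0 1" by simp
    have "g a $ i = 0" for i
    proof -
      obtain j where "j \<in> {1..\<mu> i}" "a = \<alpha> i j" using a[of i] by blast
      hence "(\<Prod>j=1..\<mu> i. (a - \<alpha> i j) / (1 - cnj (\<alpha> i j) * a)) = 0"
        by (intro prod_zero) auto
      thus ?thesis unfolding gB[OF a1] blaschke_product_def by simp
    qed
    thus False using g0[OF a1] by (simp add: vec_eq_iff)
  qed

  define x where "x z = complex_of_real (inverse (norm (g z))) *s g z" for z
  have x1: "continuous_on (cball 0 1) x"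
  proof -
    have comp: "continuous_on (cball 0 1) (\<lambda>z. g z $ i)" for i
      using g[of i] by (simp add: unimodular_disc_def)
    have "continuous_on (cball 0 1) (\<lambda>z. \<chi> i. g z $ i)"
      by (rule continuous_on_vec_lambda) (rule comp)
    hence "continuous_on (cball 0 1) g" by simp
    thus ?thesis unfolding x_def vector_scalar_mult_def
      using g0 comp by (intro continuous_intros) auto
  qed
  have x2: "homog_coords (x z) (w z)" if "z \<in> cball 0 1" for z
    unfolding x_def using g0[OF that] by (intro homog_coords_cmult homog that) simp
  have x3: "cinner (x z) (x z) = 1" if "z \<in> cball 0 1" for z
    unfolding x_def by (rule cinner_normalized[OF g0[OF that]])
  have tp: "torus_point (g \<zeta>) (x \<zeta>) (w \<zeta>)" if "\<zeta> \<in> sphere 0 1" for \<zeta>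
    unfolding x_def using g that homog[of \<zeta>]
    by (intro torus_point_normalized) (auto simp: unimodular_disc_def)

  \<comment> \<open>The trivialization and the frame are arbitrary here, which gives the uniqueness
    demanded by the definite description in \<open>maslov_index\<close>.\<close>
  have degree: "circle_degree (\<lambda>\<zeta>. det (A \<zeta> ** transpose (A \<zeta>))) = of_int (2 * (\<Sum>i\<in>UNIV. int (\<mu> i)))"
    if \<Phi>: "unitary_trivialization w \<Phi>" and A: "lagrangian_frame w \<Phi> A" for \<Phi> A
  proof -
    obtain U where U: "continuous_on (cball 0 1) U" "\<And>z. z \<in> cball 0 1 \<Longrightarrow> unitary_matrix (U z)"
      "\<And>z. z \<in> cball 0 1 \<Longrightarrow> U z *v axis None 1 = x z"
      "\<And>z u. z \<in> cball 0 1 \<Longrightarrow> \<Phi> z u = rank_one (U z *v embed_option u) (x z)"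
      by (rule frame_of_unitary_trivialization[OF \<Phi> x1 x2 x3]) blast+
    have det: "det (A \<zeta> ** transpose (A \<zeta>)) * (det (U \<zeta>))\<^sup>2 = - (det (torus_matrix (g \<zeta>)))\<^sup>2"
      if \<zeta>: "\<zeta> \<in> sphere 0 1" for \<zeta>
    proof (rule lagrangian_frame_det[OF tp[OF \<zeta>]])
      have \<zeta>': "\<zeta> \<in> cball 0 1" using \<zeta> by simp
      show "unitary_matrix (U \<zeta>)" "U \<zeta> *v axis None 1 = x \<zeta>" using U(2,3) \<zeta>' by auto
      show "unitary_matrix (A \<zeta>)" using A \<zeta> unfolding lagrangian_frame_def by blast
      have "{A \<zeta> *v s | s. \<forall>k. s $ k \<in> \<real>} =
          {u. \<Phi> \<zeta> u \<in> tangent_space_cproj clifford_torus (w \<zeta>)}"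
        using A \<zeta> unfolding lagrangian_frame_def by blast
      thus "{A \<zeta> *v s | s. \<forall>k. s $ k \<in> \<real>} =
          {u. rank_one (U \<zeta> *v embed_option u) (x \<zeta>) \<in> tangent_space_cproj clifford_torus (w \<zeta>)}"
        unfolding U(4)[OF \<zeta>'] .
    qed
    show ?thesis by (rule maslov_degree[OF gB \<alpha> U(1,2) det])
  qed

  \<comment> \<open>Existence is required as well: without any trivialization and frame the definite
    description would denote an unspecified integer.\<close>
  have ex: "\<exists>\<Phi> A. unitary_trivialization w \<Phi> \<and> lagrangian_frame w \<Phi> A"
  proof -
    have e: "cinner (axis None 1) (axis None 1 :: complex^'n option) = 1" by (simp add: cinner_axis_right)
    obtain U where U: "continuous_on (cball 0 1) U" "\<And>z. z \<in> cball 0 1 \<Longrightarrow> unitary_matrix (U z)"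
      "\<And>z. z \<in> cball 0 1 \<Longrightarrow> U z *v axis None 1 = x z"
      by (rule continuous_unitary_frame[OF x1 x3 e]) blast+
    define Q where "Q \<zeta> A \<longleftrightarrow> unitary_matrix A \<and> {A *v s | s. \<forall>k. s $ k \<in> \<real>} =
        {u. rank_one (U \<zeta> *v embed_option u) (x \<zeta>) \<in> tangent_space_cproj clifford_torus (w \<zeta>)}" for \<zeta> A
    have "\<exists>A. Q \<zeta> A" if \<zeta>: "\<zeta> \<in> sphere 0 1" for \<zeta>
    proof -
      have \<zeta>': "\<zeta> \<in> cball 0 1" using \<zeta> by simp
      show ?thesis unfolding Q_def
        by (rule lagrangian_frame_exists[OF tp[OF \<zeta>] U(2)[OF \<zeta>'] U(3)[OF \<zeta>']]) blast
    qed
    hence "\<forall>\<zeta>\<in>sphere 0 1. \<exists>A. Q \<zeta> A" by blast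
    then obtain A where "\<forall>\<zeta>\<in>sphere 0 1. Q \<zeta> (A \<zeta>)" using bchoice by metis
    hence "lagrangian_frame w (\<lambda>z u. rank_one (U z *v embed_option u) (x z)) A"
      unfolding lagrangian_frame_def Q_def .
    moreover have "unitary_trivialization w (\<lambda>z u. rank_one (U z *v embed_option u) (x z))"
      by (rule unitary_trivialization_of_frame[OF x1 x2 x3 U])
    ultimately show ?thesis by blast
  qed

  have "maslov_index w = 2 * (\<Sum>i\<in>UNIV. int (\<mu> i))"
    unfolding maslov_index_def
  proof (rule the_equality)
    show "\<exists>\<Phi> A. unitary_trivialization w \<Phi> \<and> lagrangian_frame w \<Phi> A \<and>
        circle_degree (\<lambda>\<zeta>. det (A \<zeta> ** transpose (A \<zeta>))) = of_int (2 * (\<Sum>i\<in>UNIV. int (\<mu> i)))"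
      using ex degree by blast
  next
    fix m assume "\<exists>\<Phi> A. unitary_trivialization w \<Phi> \<and> lagrangian_frame w \<Phi> A \<and>
        circle_degree (\<lambda>\<zeta>. det (A \<zeta> ** transpose (A \<zeta>))) = of_int m"
    then obtain \<Phi> A where "unitary_trivialization w \<Phi>" "lagrangian_frame w \<Phi> A"
      "circle_degree (\<lambda>\<zeta>. det (A \<zeta> ** transpose (A \<zeta>))) = of_int m" by blast
    hence "complex_of_int m = of_int (2 * (\<Sum>i\<in>UNIV. int (\<mu> i)))" using degree by metis
    thus "m = 2 * (\<Sum>i\<in>UNIV. int (\<mu> i))" by (simp only: of_int_eq_iff)
  qed
  moreover have "homog_coords (\<chi> i. blaschke_product (\<theta> i) (\<mu> i) (\<alpha> i) z) (w z)" if "z \<in> cball 0 1" for z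
    using homog[OF that] unfolding gB[OF that, symmetric] by simp
  ultimately show ?thesis
    using \<alpha> \<open>(\<Inter>i. \<Union>j\<in>{1..\<mu> i}. {\<alpha> i j}) = {}\<close>
    by (intro exI[of _ \<mu>] exI[of _ \<theta>] exI[of _ \<alpha>] conjI allI ballI)
qed

end
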